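(* Let $A\in\mathbb R^{n\times n}$ be symmetric with $[\lambda_{\min},\lambda_{\max}]=[-1,1]$, and let $M\ge2$ and $\ell\ge1$ be integers. Label the eigenvalues of $A$ in $[a,b]\subset[\lambda_{\min},\lambda_{\max}]$ ($a<b$), counting multiplicities, as $\lambda_1,\dots,\lambda_{n_{ev}}$ with $b\ge\lambda_1\ge\cdots\ge\lambda_{n_{ev}}\ge a$, suppose that the multiplicity of each of them does not exceed $\ell$, and write the eigenvalues outside $[a,b]$ as $\lambda_{n_{ev}+1},\dots,\lambda_n$ at will. Given $1\le i\le n_{ev}$, assume that $\lambda_{i-1}\ne\lambda_i$ for $i>1$ and that the cardinality $|\Xi_i|\le M-1$, where $\Xi_i$ is the set of the distinct eigenvalues among $\lambda_1,\dots,\lambda_{i-1}$. Define $$\sigma_i=1+\frac{2(\lambda_i-\lambda_{i+\ell})}{\lambda_{i+\ell}-a},\qquad m_i(t)=\begin{cases}\prod_{\lambda_j\in\Xi_i}(t-\lambda_j),&i\ne1,\\1,&i=1,\end{cases}\qquad \kappa_i=\frac{\|m_i\|_{L_\infty(a,b)}}{|m_i(\lambda_i)|},$$ $$\varepsilon_i=\begin{cases}\kappa_i/T_{M-|\Xi_i|-1}(\sigma_i),&i=1,\dots,n_{ev}-\ell,\\0,&i=n_{ev}-\ell+1,\dots,n_{ev},\end{cases}$$ $$\tau_i=\begin{cases}\varepsilon_i\cdot T_{M-|\Xi_i|-1}\!\left(1+\dfrac{2(b-\lambda_{i+\ell})}{\lambda_{i+\ell}-a}\right),&i=1,\dots,n_{ev}-\ell,\\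 \kappa_i,&i=n_{ev}-\ell+1,\dots,n_{ev},\end{cases}$$ $$\hat\gamma_i=\frac{\pi^6\tau_i}{\Delta_{\min}^4(d+2)^3},\qquad \hat\delta_i=\left(\frac{\pi^2(M-1)^2}{(b-a)(d+2)}\right)^2\frac{\tau_i}{2},\qquad \hat\eta_i=\frac{\pi^2(M-1)^2}{(b-a)(d+2)}\,\frac{\tau_i}{2},$$ where $\Delta_{\min}$ is defined in the context, and $$\mu_i=\hat\gamma_i+\max\Bigl\{\varepsilon_i+\hat\delta_i,\ \frac{\varepsilon_i}{2}+\hat\eta_i\Bigr\},\qquad \nu_i=\begin{cases}1-\hat\gamma_i-\hat\delta_i,&\lambda_i\in(a,b),\\ \frac12-\hat\gamma_i-\hat\eta_i,&\lambda_i\in\{a,b\}.\end{cases}$$ Then for sufficiently large CJ series degree $d$ such that $\nu_i$ is uniformly positive, we have $$\min_{\substack{p\in\mathcal P_{M-1}\\ F_d(p)(\lambda_i)\ne0}}\ \max_{j\in N_i}\frac{|F_d(p)(\lambda_j)|}{|F_d(p)(\lambda_i)|}\le\frac{\mu_i}{\nu_i},\qquad N_i=\{1,2,\dots,n\}\setminus\{i,\dots,i+\ell-1\}.$$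
   Context: $\lambda_{\min},\lambda_{\max}$ are the smallest and largest eigenvalues of $A$. $\mathcal P_{M-1}$ is the set of real polynomials of degree not exceeding $M-1$; $\|f\|_{L_\infty(a,b)}=\sup_{t\in(a,b)}|f(t)|$; $T_j$ is the Chebyshev polynomial of the first kind of degree $j$. The Chebyshev--Jackson (CJ) series expansion of degree $d$ associated with $p$ and $[a,b]$ is the polynomial $$F_d(p)(t)=\frac{c_0}{2}+\sum_{j=1}^d\rho_{j,d}\,c_j\,T_j(t),\qquad c_j=\frac2\pi\int_a^b\frac{p(t)T_j(t)}{\sqrt{1-t^2}}\,dt,$$ with the Jackson damping factors $$\rho_{j,d}=\frac{\sin((j+1)\alpha_d)}{(d+2)\sin(\alpha_d)}+\Bigl(1-\frac{j+1}{d+2}\Bigr)\cos(j\alpha_d),\qquad \alpha_d=\frac{\pi}{d+2}.$$ Let $\lambda_{ia},\lambda_{ib}$ and $\lambda_{oa},\lambda_{ob}$ be the eigenvalues of $A$ closest to the ends $a$ and $b$ inside and outside $[a,b]$, respectively. With $\alpha=\arccos(a)$, $\beta=\arccos(b)$, $$\Delta_{\min}=\min\{|\alpha-\arccos(\lambda_{ia})|,\ |\alpha-\arccos(\lambda_{oa})|,\ |\beta-\arccos(\lambda_{ib})|,\ |\beta-\arccos(\lambda_{ob})|\}.$$ *)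

theory Defs
  imports "HOL-Analysis.Analysis" "Jordan_Normal_Form.Spectral_Radius"
begin

section \<open>Chebyshev--Jackson series\<close>

text \<open>Chebyshev polynomials of the first kind.\<close>

fun cheb_T :: "nat \<Rightarrow> real poly" where
  "cheb_T 0 = 1"
| "cheb_T (Suc 0) = [:0, 1:]"
| "cheb_T (Suc (Suc j)) = [:0, 2:] * cheb_T (Suc j) - cheb_T j"

text \<open>The integrand is unbounded at an endpoint \<open>\<plusminus>1\<close>; the Henstock--Kurzweil integral covers this
  improper case, and the value \<open>x / 0 = 0\<close> at that single point is irrelevant.\<close>

definition cheb_coeff :: "real \<Rightarrow> real \<Rightarrow> real poly \<Rightarrow> nat \<Rightarrow> real" where
  "cheb_coeff a b p j =
     2 / pi * integral {a..b} (\<lambda>t. poly p t * poly (cheb_T j) t / sqrt (1 - t\<^sup>2))"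

definition jackson_angle :: "nat \<Rightarrow> real" where
  "jackson_angle d = pi / real (d + 2)"

definition jackson_factor :: "nat \<Rightarrow> nat \<Rightarrow> real" where
  "jackson_factor j d =
     sin (real (j + 1) * jackson_angle d) / (real (d + 2) * sin (jackson_angle d))
     + (1 - real (j + 1) / real (d + 2)) * cos (real j * jackson_angle d)"

definition CJ_series :: "real \<Rightarrow> real \<Rightarrow> nat \<Rightarrow> real poly \<Rightarrow> real poly" where
  "CJ_series a b d p =
     [:cheb_coeff a b p 0 / 2:]
     + (\<Sum>j=1..d. Polynomial.smult (jackson_factor j d * cheb_coeff a b p j) (cheb_T j))"


section \<open>Distance of the spectrum to the ends of the interval\<close>

text \<open>The distances entering \<open>\<Delta>\<^sub>m\<^sub>i\<^sub>n\<close>.  ``Inside'' means in the open interval \<open>(a, b)\<close>: an end of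
  the interval may itself be an eigenvalue, and counting it would make \<open>\<Delta>\<^sub>m\<^sub>i\<^sub>n = 0\<close>, by which one
  divides later.  The eigenvalue outside the interval closest to \<open>a\<close> is the largest one below \<open>a\<close>,
  that closest to \<open>b\<close> the smallest one above \<open>b\<close>.  Eigenvalues that do not exist (for example,
  one below \<open>a\<close> if \<open>a\<close> is the smallest eigenvalue) contribute no distance.\<close>

definition end_distances :: "real mat \<Rightarrow> real \<Rightarrow> real \<Rightarrow> real set" where
  "end_distances A a b =
    (let inner = {x \<in> spectrum A. a < x \<and> x < b};
         below = {x \<in> spectrum A. x < a};
         above = {x \<in> spectrum A. b < x}
     in (if inner = {} then {}
         else {\<bar>arccos a - arccos (Min inner)\<bar>, \<bar>arccos b - arccos (Max inner)\<bar>})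
        \<union> (if below = {} then {} else {\<bar>arccos a - arccos (Max below)\<bar>})
        \<union> (if above = {} then {} else {\<bar>arccos b - arccos (Min above)\<bar>}))"

text \<open>All distances are at most \<open>\<pi>\<close>, so inserting \<open>\<pi>\<close> changes nothing unless there is no
  distance at all, which, for a spectrum with extreme points \<open>\<plusminus>1\<close>, happens only if the interval
  is \<open>[-1, 1]\<close> and the spectrum is \<open>{-1, 1}\<close>.\<close>

definition Delta_min :: "real mat \<Rightarrow> real \<Rightarrow> real \<Rightarrow> real" where
  "Delta_min A a b = Min (insert pi (end_distances A a b))"


section \<open>The quantities in the estimate\<close>

text \<open>Throughout, \<open>lam j\<close> with \<open>1 \<le> j \<le> n\<close> is the \<open>j\<close>-th eigenvalue in the chosen labelling.\<close>

definition Xi :: "(nat \<Rightarrow> real) \<Rightarrow> nat \<Rightarrow> real set" where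
  "Xi lam i = lam ` {1..<i}"

text \<open>For \<open>i = 1\<close> this is the empty product \<open>1\<close>.\<close>

definition m_poly :: "(nat \<Rightarrow> real) \<Rightarrow> nat \<Rightarrow> real poly" where
  "m_poly lam i = (\<Prod>x\<in>Xi lam i. [:- x, 1:])"

definition kappa :: "real \<Rightarrow> real \<Rightarrow> (nat \<Rightarrow> real) \<Rightarrow> nat \<Rightarrow> real" where
  "kappa a b lam i =
     (SUP t\<in>{a<..<b}. \<bar>poly (m_poly lam i) t\<bar>) / \<bar>poly (m_poly lam i) (lam i)\<bar>"

text \<open>If \<open>lam (i + l) = a\<close>, the fraction is undefined on paper; here \<open>x / 0 = 0\<close> gives
  \<open>sigma = 1\<close>, hence \<open>eps = tau = kappa\<close> below.\<close>

definition sigma :: "real \<Rightarrow> (nat \<Rightarrow> real) \<Rightarrow> nat \<Rightarrow> nat \<Rightarrow> real" where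
  "sigma a lam l i = 1 + 2 * (lam i - lam (i + l)) / (lam (i + l) - a)"

definition eps ::
    "real \<Rightarrow> real \<Rightarrow> (nat \<Rightarrow> real) \<Rightarrow> nat \<Rightarrow> nat \<Rightarrow> nat \<Rightarrow> nat \<Rightarrow> real" where
  "eps a b lam nev M l i =
     (if i + l \<le> nev
      then kappa a b lam i / poly (cheb_T (M - card (Xi lam i) - 1)) (sigma a lam l i)
      else 0)"

definition tau ::
    "real \<Rightarrow> real \<Rightarrow> (nat \<Rightarrow> real) \<Rightarrow> nat \<Rightarrow> nat \<Rightarrow> nat \<Rightarrow> nat \<Rightarrow> real" where
  "tau a b lam nev M l i =
     (if i + l \<le> nev
      then eps a b lam nev M l i *
           poly (cheb_T (M - card (Xi lam i) - 1))
             (1 + 2 * (b - lam (i + l)) / (lam (i + l) - a))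
      else kappa a b lam i)"

definition gamma_hat ::
    "real mat \<Rightarrow> real \<Rightarrow> real \<Rightarrow> (nat \<Rightarrow> real) \<Rightarrow> nat \<Rightarrow> nat \<Rightarrow> nat \<Rightarrow> nat \<Rightarrow> nat \<Rightarrow> real" where
  "gamma_hat A a b lam nev M l i d =
     pi ^ 6 * tau a b lam nev M l i / (Delta_min A a b ^ 4 * real (d + 2) ^ 3)"

definition delta_hat ::
    "real \<Rightarrow> real \<Rightarrow> (nat \<Rightarrow> real) \<Rightarrow> nat \<Rightarrow> nat \<Rightarrow> nat \<Rightarrow> nat \<Rightarrow> nat \<Rightarrow> real" where
  "delta_hat a b lam nev M l i d =
     (pi\<^sup>2 * (real M - 1)\<^sup>2 / ((b - a) * real (d + 2)))\<^sup>2 * (tau a b lam nev M l i / 2)"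

definition eta_hat ::
    "real \<Rightarrow> real \<Rightarrow> (nat \<Rightarrow> real) \<Rightarrow> nat \<Rightarrow> nat \<Rightarrow> nat \<Rightarrow> nat \<Rightarrow> nat \<Rightarrow> real" where
  "eta_hat a b lam nev M l i d =
     pi\<^sup>2 * (real M - 1)\<^sup>2 / ((b - a) * real (d + 2)) * (tau a b lam nev M l i / 2)"

definition mu ::
    "real mat \<Rightarrow> real \<Rightarrow> real \<Rightarrow> (nat \<Rightarrow> real) \<Rightarrow> nat \<Rightarrow> nat \<Rightarrow> nat \<Rightarrow> nat \<Rightarrow> nat \<Rightarrow> real" where
  "mu A a b lam nev M l i d =
     gamma_hat A a b lam nev M l i d
     + max (eps a b lam nev M l i + delta_hat a b lam nev M l i d)
           (eps a b lam nev M l i / 2 + eta_hat a b lam nev M l i d)"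

definition nu ::
    "real mat \<Rightarrow> real \<Rightarrow> real \<Rightarrow> (nat \<Rightarrow> real) \<Rightarrow> nat \<Rightarrow> nat \<Rightarrow> nat \<Rightarrow> nat \<Rightarrow> nat \<Rightarrow> real" where
  "nu A a b lam nev M l i d =
     (if a < lam i \<and> lam i < b
      then 1 - gamma_hat A a b lam nev M l i d - delta_hat a b lam nev M l i d
      else 1 / 2 - gamma_hat A a b lam nev M l i d - eta_hat a b lam nev M l i d)"

text \<open>The maximum over \<open>j \<in> N\<^sub>i\<close>.  Since the ratios are nonnegative, inserting \<open>0\<close> only fixes the
  value \<open>0\<close> for the empty maximum, which occurs for \<open>i = 1\<close> and \<open>l \<ge> n\<close>.\<close>

definition CJ_max_ratio ::
    "real \<Rightarrow> real \<Rightarrow> nat \<Rightarrow> (nat \<Rightarrow> real) \<Rightarrow> nat \<Rightarrow> nat \<Rightarrow> nat \<Rightarrow> real poly \<Rightarrow> real" where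
  "CJ_max_ratio a b d lam n l i p =
     Max (insert 0 ((\<lambda>j. \<bar>poly (CJ_series a b d p) (lam j)\<bar> / \<bar>poly (CJ_series a b d p) (lam i)\<bar>)
                    ` ({1..n} - {i..<i + l})))"

definition CJ_admissible ::
    "real \<Rightarrow> real \<Rightarrow> nat \<Rightarrow> (nat \<Rightarrow> real) \<Rightarrow> nat \<Rightarrow> nat \<Rightarrow> real poly \<Rightarrow> bool" where
  "CJ_admissible a b d lam M i p \<longleftrightarrow>
     degree p \<le> M - 1 \<and> poly (CJ_series a b d p) (lam i) \<noteq> 0"

end

theory Submission
  imports Defs
begin

text \<open>The Jackson damping factors are the autocorrelation of a sine sequence, so
  \<open>F\<^sub>d(p)(cos \<theta>)\<close> is the mean of \<open>p(cos (\<theta> + s))\<close>, cut off outside \<open>[a, b]\<close>, against a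
  nonnegative even kernel in \<open>s\<close> whose first two moments of \<open>1 - cos s\<close> are
  \<open>O(d\<^sup>-\<^sup>2)\<close> and \<open>O(d\<^sup>-\<^sup>3)\<close>.  Every error estimate reduces to a pointwise bound of the
  symmetrised integrand by a quadratic polynomial in \<open>1 - cos s\<close>: the second moment controls what
  the cut-off does at angular distance at least \<open>\<Delta>\<^sub>m\<^sub>i\<^sub>n\<close> (giving \<open>\<gamma>\<close>), and Markov-type
  inequalities for the first two derivatives control the smooth part (giving \<open>\<delta>\<close> inside and
  \<open>\<eta>\<close> at an end of the interval, where only half of the kernel sees \<open>p\<close>).  These
  estimates are applied to the product of \<open>m\<^sub>i\<close> and a Chebyshev polynomial that is small on
  \<open>[a, \<lambda>\<^sub>i\<^sub>+\<^sub>l]\<close>, normalised to \<open>1\<close> at \<open>\<lambda>\<^sub>i\<close>.  The minimum is attained because, after the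
  normalisation \<open>F\<^sub>d(p)(\<lambda>\<^sub>i) = 1\<close>, it is a best approximation problem in finite dimension.\<close>

section \<open>Chebyshev polynomials and Markov-type inequalities\<close>

text \<open>The cut-off of p jumps at a and b, so no uniform rate can hold there; the estimate is
  claimed at eigenvalues only, and \<Delta> is the room they leave around the jumps. The target
  constants dictate the pointwise bounds. With moments at most pi^2/(2(d+2)^2) and 2pi^2/(d+2)^3,
  the coefficient pi^4 \<tau>/(2\<Delta>^4) of (1 - cos s)^2 yields exactly \<gamma>, and pi^2
  (M-1)^4 \<tau>/(b-a)^2 in front of 1 - cos s yields exactly \<delta>. At an end of the interval
  the error is only Lipschitz, of size s instead of s^2; splitting it by the arithmetic-geometric
  mean at the scale pi/(d+2) is why \<eta> is of first order in 1/(d+2). The Markov inequalities are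
  sharp at an endpoint and lossy elsewhere; the resulting constants 9 and 3 still lie below pi^2 and
  pi. An end equal to -1 or 1 is a separate case: there F is close to p and not to p/2, although
  \<nu> has the same form as at any other end. Positivity of \<nu> also has to exclude d < 2, for
  which the kernel contains no second frequency.\<close>

lemma poly_cheb_T_cos: "poly (cheb_T k) (cos t) = cos (real k * t)"
proof (induction k rule: cheb_T.induct)
  case (3 j)
  have "cos (real (Suc j) * t + t) + cos (real (Suc j) * t - t) = 2 * cos t * cos (real (Suc j) * t)"
    by (simp add: cos_add cos_diff)
  moreover have "real (Suc j) * t + t = real (Suc (Suc j)) * t" "real (Suc j) * t - t = real j * t"
    by (simp_all add: algebra_simps)
  ultimately show ?case using 3 by (simp add: algebra_simps)
qed simp_all

lemma poly_cheb_T_cosh: "poly (cheb_T k) (cosh t) = cosh (real k * t)"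
proof (induction k rule: cheb_T.induct)
  case (3 j)
  have "cosh (real (Suc j) * t + t) + cosh (real (Suc j) * t - t) = 2 * cosh t * cosh (real (Suc j) * t)"
    by (simp add: cosh_add cosh_diff)
  moreover have "real (Suc j) * t + t = real (Suc (Suc j)) * t" "real (Suc j) * t - t = real j * t"
    by (simp_all add: algebra_simps)
  ultimately show ?case using 3 by (simp add: algebra_simps)
qed simp_all

lemma abs_poly_cheb_T_le_1:
  assumes "\<bar>x\<bar> \<le> 1"
  shows "\<bar>poly (cheb_T k) x\<bar> \<le> 1"
  using assms poly_cheb_T_cos[of k "arccos x"] by (simp add: cos_arccos_abs)

text \<open>Beyond 1 every argument is \<open>cosh t\<close> with t >= 0, and
  \<open>cosh (k * t)\<close> increases in t.\<close>

lemma poly_cheb_T_mono: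
  assumes "1 \<le> x" "x \<le> y"
  shows "poly (cheb_T k) x \<le> poly (cheb_T k) y"
proof -
  have "0 \<le> arcosh x" using assms by simp
  moreover have "arcosh x \<le> arcosh y"
    using arcosh_real_strict_mono[of x y] assms by (cases "x = y") (auto intro: less_imp_le)
  ultimately have "cosh (real k * arcosh x) \<le> cosh (real k * arcosh y)"
    by (subst cosh_real_nonneg_le_iff) (auto intro: mult_left_mono)
  then show ?thesis
    using assms poly_cheb_T_cosh[of k "arcosh x"] poly_cheb_T_cosh[of k "arcosh y"] by simp
qed

lemma poly_cheb_T_1: "poly (cheb_T k) 1 = 1"
  using poly_cheb_T_cos[of k 0] by simp

lemma poly_cheb_T_ge_1:
  assumes "1 \<le> x"
  shows "1 \<le> poly (cheb_T k) x"
  using poly_cheb_T_mono[of 1 x k] assms by (simp add: poly_cheb_T_1)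

lemma degree_cheb_T_le: "degree (cheb_T k) \<le> k"
proof (induction k rule: cheb_T.induct)
  case (3 j)
  have "degree ([:0, 2:] * cheb_T (Suc j)) \<le> Suc (Suc j)"
    using 3 degree_mult_le[of "[:0, 2:]" "cheb_T (Suc j)"] by simp
  then show ?case using 3 by (auto intro!: degree_diff_le)
qed simp_all

lemma pderiv_cheb_T_Suc_Suc:
  "pderiv (cheb_T (Suc (Suc j)))
     = [:2:] * cheb_T (Suc j) + [:0, 2:] * pderiv (cheb_T (Suc j)) - pderiv (cheb_T j)"
proof -
  have "pderiv [:0, 2:] = [:2 :: real:]" by (simp add: pderiv_pCons)
  then show ?thesis unfolding cheb_T.simps pderiv_diff pderiv_mult by (simp only: mult.commute add.commute)
qed

lemma pderiv2_cheb_T_Suc_Suc: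
  "pderiv (pderiv (cheb_T (Suc (Suc j))))
     = [:4:] * pderiv (cheb_T (Suc j)) + [:0, 2:] * pderiv (pderiv (cheb_T (Suc j)))
       - pderiv (pderiv (cheb_T j))"
proof -
  have "pderiv [:0, 2:] = [:2 :: real:]" "pderiv [:2 :: real:] = 0" by (simp_all add: pderiv_pCons)
  then show ?thesis
    unfolding pderiv_cheb_T_Suc_Suc pderiv_diff pderiv_add pderiv_mult
    by (simp add: mult.commute add.commute smult_add_left[symmetric] numeral_mult_conv_smult)
qed

text \<open>The substitution x = cos t is singular at x = 1, so the derivatives there are computed
  from the differentiated three-term recurrence.\<close>

lemma poly_pderiv_cheb_T_1: "poly (pderiv (cheb_T k)) 1 = (real k)\<^sup>2"
proof (induction k rule: cheb_T.induct)
  case (3 j)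
  then show ?case
    unfolding pderiv_cheb_T_Suc_Suc
    by (simp add: poly_cheb_T_1 power2_eq_square algebra_simps del: cheb_T.simps)
qed (simp_all add: pderiv_pCons)

lemma poly_pderiv2_cheb_T_1:
  "poly (pderiv (pderiv (cheb_T k))) 1 = (real k)\<^sup>2 * ((real k)\<^sup>2 - 1) / 3"
proof (induction k rule: cheb_T.induct)
  case (3 j)
  then show ?case
    unfolding pderiv2_cheb_T_Suc_Suc
    by (simp add: poly_pderiv_cheb_T_1 power2_eq_square field_simps del: cheb_T.simps)
qed (simp_all add: pderiv_pCons)

section \<open>Markov inequalities from interpolation at the Chebyshev extremal points\<close>

definition lagrange_num :: "(nat \<Rightarrow> real) \<Rightarrow> nat \<Rightarrow> nat \<Rightarrow> real poly" where
  "lagrange_num x n j = (\<Prod>m\<in>{..n}-{j}. [:- x m, 1:])"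

text \<open>Numerators and denominators are kept apart because they serve different purposes: a
  functional is nonnegative on the numerators, while the signs alternate in the
  denominators.\<close>

lemma lagrange_interpolation:
  assumes inj: "inj_on x {..n}" and deg: "degree p \<le> n"
  shows "p = (\<Sum>j\<le>n. Polynomial.smult (poly p (x j) / poly (lagrange_num x n j) (x j)) (lagrange_num x n j))"
    (is "p = ?q")
proof (rule poly_eqI_degree)
  have degnum: "degree (lagrange_num x n j) \<le> n" if "j \<le> n" for j
  proof -
    have "degree (lagrange_num x n j) \<le> (\<Sum>m\<in>{..n}-{j}. degree [:- x m, 1:])"
      unfolding lagrange_num_def by (rule order_trans[OF degree_prod_sum_le]) auto
    also have "\<dots> = n" using that by simp
    finally show ?thesis .
  qed
  show "card (x ` {..n}) > degree p"
    using deg card_image[OF inj] by simp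
  have "degree ?q \<le> n"
    by (rule degree_sum_le) (auto intro: order_trans[OF degree_smult_le] degnum)
  then show "card (x ` {..n}) > degree ?q"
    using card_image[OF inj] by simp
next
  fix y assume "y \<in> x ` {..n}"
  then obtain k where k: "k \<le> n" "y = x k" by auto
  have off: "poly (lagrange_num x n j) (x k) = 0" if "j \<noteq> k" for j
    using that k by (auto simp: lagrange_num_def poly_prod)
  have diag: "poly (lagrange_num x n k) (x k) \<noteq> 0"
    using inj k by (auto simp: lagrange_num_def poly_prod inj_on_def)
  have "poly ?q y = (\<Sum>j\<le>n. if j = k then poly p (x k) else 0)"
    unfolding poly_sum k by (rule sum.cong) (use off diag in auto)
  then show "poly p y = poly ?q y" using k by simp
qed

text \<open>The nodes are the extremal points of \<open>cheb_T n\<close>, where the values of \<open>cheb_T n\<close> alternate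
  between \<open>1\<close> and \<open>- 1\<close> exactly as the Lagrange denominators change sign.\<close>

lemma cheb_T_extremal:
  fixes \<Lambda> :: "real poly \<Rightarrow> real"
  assumes n: "n \<ge> 1" and deg: "degree p \<le> n"
    and bnd: "\<And>x. \<bar>x\<bar> \<le> 1 \<Longrightarrow> \<bar>poly p x\<bar> \<le> B"
    and add: "\<And>p q. \<Lambda> (p + q) = \<Lambda> p + \<Lambda> q"
    and scale: "\<And>c p. \<Lambda> (Polynomial.smult c p) = c * \<Lambda> p"
    and pos: "\<And>(S :: nat set) x. finite S \<Longrightarrow> (\<And>m. m \<in> S \<Longrightarrow> x m \<le> 1) \<Longrightarrow>
               0 \<le> \<Lambda> (\<Prod>m\<in>S. [:- x m, 1:])"
  shows "\<bar>\<Lambda> p\<bar> \<le> B * \<Lambda> (cheb_T n)"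
proof -
  define x where "x j = cos (real j * (pi / real n))" for j
  define D where "D j = poly (lagrange_num x n j) (x j)" for j
  have arg: "real j * (pi / real n) \<le> pi" if "j \<le> n" for j
    using that n by (simp add: field_simps)
  have anti: "x k < x j" if "j < k" "k \<le> n" for j k
    unfolding x_def
    by (rule cos_monotone_0_pi) (use that n arg[of k] in \<open>auto simp: divide_strict_right_mono\<close>)
  have inj: "inj_on x {..n}"
  proof (rule inj_onI, rule ccontr)
    fix j k assume "j \<in> {..n}" "k \<in> {..n}" "x j = x k" "j \<noteq> k"
    then show False using anti[of j k] anti[of k j] by (cases "j < k") auto
  qed
  have T: "poly (cheb_T n) (x j) = (-1) ^ j" for j
  proof -
    have "real n * (real j * (pi / real n)) = real j * pi" using n by simp
    then show ?thesis by (simp only: x_def poly_cheb_T_cos cos_npi)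
  qed
  have D: "(-1) ^ j * D j > 0" if "j \<le> n" for j
  proof -
    have split: "{..n} - {j} = {..<j} \<union> {j<..n}" using that by auto
    have "D j = (\<Prod>m<j. x j - x m) * (\<Prod>m\<in>{j<..n}. x j - x m)"
      unfolding D_def lagrange_num_def poly_prod split by (subst prod.union_disjoint) auto
    moreover have "(\<Prod>m<j. x j - x m) = (\<Prod>m<j. (-1) * (x m - x j))" by simp
    then have "(\<Prod>m<j. x j - x m) = (-1) ^ j * (\<Prod>m<j. x m - x j)"
      by (simp only: prod.distrib) simp
    ultimately have "(-1) ^ j * D j = (\<Prod>m<j. x m - x j) * (\<Prod>m\<in>{j<..n}. x j - x m)"
      by (simp flip: mult.assoc power_mult_distrib)
    then show ?thesis using anti that by (auto intro!: mult_pos_pos prod_pos)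
  qed
  have \<Lambda>0: "\<Lambda> 0 = 0" using scale[of 0 0] by simp
  have sumL: "\<Lambda> (\<Sum>j\<in>S. f j) = (\<Sum>j\<in>S. \<Lambda> (f j))" for f :: "nat \<Rightarrow> real poly" and S
    by (induction S rule: infinite_finite_induct) (simp_all add: \<Lambda>0 add)
  have expand: "\<Lambda> q = (\<Sum>j\<le>n. poly q (x j) / D j * \<Lambda> (lagrange_num x n j))" if "degree q \<le> n" for q
    unfolding D_def using arg_cong[OF lagrange_interpolation[OF inj that], of \<Lambda>]
    by (simp add: sumL scale)
  have nn: "0 \<le> \<Lambda> (lagrange_num x n j)" for j
    unfolding lagrange_num_def by (rule pos) (auto simp: x_def)
  have "\<bar>\<Lambda> p\<bar> \<le> (\<Sum>j\<le>n. \<bar>poly p (x j) / D j * \<Lambda> (lagrange_num x n j)\<bar>)"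
    unfolding expand[OF deg] by (rule sum_abs)
  also have "\<dots> \<le> (\<Sum>j\<le>n. B * (poly (cheb_T n) (x j) / D j * \<Lambda> (lagrange_num x n j)))"
  proof (rule sum_mono)
    fix j assume "j \<in> {..n}"
    then have "(-1) ^ j * D j > 0" using D by simp
    then have "(-1) ^ j / D j = 1 / \<bar>D j\<bar>"
      by (cases "even j") (auto simp: zero_less_mult_iff)
    moreover have "\<bar>poly p (x j)\<bar> \<le> B" by (rule bnd) (simp add: x_def)
    then have "\<bar>poly p (x j)\<bar> * (\<Lambda> (lagrange_num x n j) / \<bar>D j\<bar>) \<le> B * (\<Lambda> (lagrange_num x n j) / \<bar>D j\<bar>)"
      using nn[of j] by (intro mult_right_mono) auto
    ultimately show "\<bar>poly p (x j) / D j * \<Lambda> (lagrange_num x n j)\<bar>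
        \<le> B * (poly (cheb_T n) (x j) / D j * \<Lambda> (lagrange_num x n j))"
      using nn[of j] by (simp add: T abs_mult mult_ac)
  qed
  also have "\<dots> = B * \<Lambda> (cheb_T n)"
    unfolding expand[OF degree_cheb_T_le] by (simp add: sum_distrib_left)
  finally show ?thesis .
qed

text \<open>A new factor t - x has value 1 - x >= 0 and slope 1 at 1, so each derivative of the
  larger product involves the same and the preceding derivative of the smaller one. This couples the
  three claims in one induction.\<close>

lemma derivs_prod_linear_nonneg:
  assumes "finite S" "\<And>m. m \<in> S \<Longrightarrow> x m \<le> (1::real)"
  defines "q \<equiv> \<Prod>m\<in>S. [:- x m, 1:]"
  shows "0 \<le> poly q 1 \<and> 0 \<le> poly (pderiv q) 1 \<and> 0 \<le> poly (pderiv (pderiv q)) 1"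
  using assms(1,2) unfolding q_def
proof (induction S)
  case (insert m S)
  then show ?case
    by (auto simp: pderiv_mult pderiv_add pderiv_pCons pderiv_1 simp del: mult_pCons_left)
qed (simp add: pderiv_1)

text \<open>Either derivative, evaluated at 1, is a functional that is nonnegative on products with
  roots at most 1; hence \<open>cheb_T n\<close> is extremal for it.\<close>

lemma markov_at_1:
  assumes "n \<ge> 1" "degree p \<le> n" "\<And>x. \<bar>x\<bar> \<le> 1 \<Longrightarrow> \<bar>poly p x\<bar> \<le> B"
  shows "\<bar>poly (pderiv p) 1\<bar> \<le> B * (real n)\<^sup>2"
    and "\<bar>poly (pderiv (pderiv p)) 1\<bar> \<le> B * ((real n)\<^sup>2 * ((real n)\<^sup>2 - 1) / 3)"
proof -
  have "\<bar>poly (pderiv p) 1\<bar> \<le> B * poly (pderiv (cheb_T n)) 1"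
    using derivs_prod_linear_nonneg by (intro cheb_T_extremal assms) (auto simp: pderiv_add pderiv_smult)
  then show "\<bar>poly (pderiv p) 1\<bar> \<le> B * (real n)\<^sup>2" by (simp add: poly_pderiv_cheb_T_1)
  have "\<bar>poly (pderiv (pderiv p)) 1\<bar> \<le> B * poly (pderiv (pderiv (cheb_T n))) 1"
    using derivs_prod_linear_nonneg
    by (intro cheb_T_extremal[where \<Lambda> = "\<lambda>p. poly (pderiv (pderiv p)) 1"] assms)
      (auto simp: pderiv_add pderiv_smult)
  then show "\<bar>poly (pderiv (pderiv p)) 1\<bar> \<le> B * ((real n)\<^sup>2 * ((real n)\<^sup>2 - 1) / 3)"
    by (simp add: poly_pderiv2_cheb_T_1)
qed

text \<open>The affine map \<open>r\<close> sends 1 to x and -1 to c, in either order on the line,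
  and each differentiation brings out a factor (x - c)/2.\<close>

lemma markov_endpoint:
  fixes c x :: real
  assumes "n \<ge> 1" "degree p \<le> n" "c \<noteq> x"
    and bnd: "\<And>y. y \<in> closed_segment c x \<Longrightarrow> \<bar>poly p y\<bar> \<le> B"
  shows "\<bar>poly (pderiv p) x\<bar> \<le> 2 / \<bar>x - c\<bar> * (B * (real n)\<^sup>2)"
    and "\<bar>poly (pderiv (pderiv p)) x\<bar>
           \<le> (2 / \<bar>x - c\<bar>)\<^sup>2 * (B * ((real n)\<^sup>2 * ((real n)\<^sup>2 - 1) / 3))"
proof -
  define r where "r = [:(c + x) / 2, (x - c) / 2:]"
  define q where "q = pcompose p r"
  have r1: "poly r 1 = x" by (simp add: r_def field_simps)
  have dr: "pderiv r = [:(x - c) / 2:]" by (simp add: r_def pderiv_pCons)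
  have "degree q \<le> degree p * 1"
    unfolding q_def by (rule order_trans[OF degree_pcompose_le]) (simp add: r_def)
  then have deg: "degree q \<le> n" using assms by simp
  have bq: "\<bar>poly q t\<bar> \<le> B" if "\<bar>t\<bar> \<le> 1" for t
  proof -
    have "poly r t = (1 - (1 + t) / 2) * c + (1 + t) / 2 * x"
      by (simp add: r_def field_simps)
    then have "poly r t \<in> closed_segment c x"
      unfolding closed_segment_def using that by (auto intro!: exI[of _ "(1 + t) / 2"])
    then show ?thesis by (simp add: q_def poly_pcompose bnd)
  qed
  have d1: "pderiv q = Polynomial.smult ((x - c) / 2) (pcompose (pderiv p) r)"
    by (simp add: q_def pderiv_pcompose dr)
  then have d2: "pderiv (pderiv q) = Polynomial.smult (((x - c) / 2)\<^sup>2) (pcompose (pderiv (pderiv p)) r)"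
    by (simp add: pderiv_smult pderiv_pcompose dr power2_eq_square)
  have "\<bar>x - c\<bar> / 2 * \<bar>poly (pderiv p) x\<bar> \<le> B * (real n)\<^sup>2"
    using markov_at_1(1)[OF assms(1) deg bq] by (simp add: d1 poly_pcompose r1 abs_mult)
  then show "\<bar>poly (pderiv p) x\<bar> \<le> 2 / \<bar>x - c\<bar> * (B * (real n)\<^sup>2)"
    using assms(3) by (simp add: field_simps)
  have "(\<bar>x - c\<bar> / 2)\<^sup>2 * \<bar>poly (pderiv (pderiv p)) x\<bar> \<le> B * ((real n)\<^sup>2 * ((real n)\<^sup>2 - 1) / 3)"
    using markov_at_1(2)[OF assms(1) deg bq] by (simp add: d2 poly_pcompose r1 abs_mult power_divide)
  moreover have "(\<bar>x - c\<bar> / 2)\<^sup>2 > 0" using assms(3) by simp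
  ultimately have "\<bar>poly (pderiv (pderiv p)) x\<bar>
      \<le> B * ((real n)\<^sup>2 * ((real n)\<^sup>2 - 1) / 3) / (\<bar>x - c\<bar> / 2)\<^sup>2"
    by (simp only: pos_le_divide_eq mult.commute)
  moreover have "X / (t / 2)\<^sup>2 = (2 / t)\<^sup>2 * X" for X t :: real
    by (simp add: power_divide)
  ultimately show "\<bar>poly (pderiv (pderiv p)) x\<bar>
           \<le> (2 / \<bar>x - c\<bar>)\<^sup>2 * (B * ((real n)\<^sup>2 * ((real n)\<^sup>2 - 1) / 3))"
    by simp
qed

text \<open>An inner point is an endpoint of the longer of the two pieces into which it cuts the
  interval. That piece has at least half the length, which costs a factor 2 for the first and 4 for
  the second derivative.\<close>

lemma markov_interval:
  fixes a b x B :: real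
  assumes ab: "a < b" and n: "n \<ge> 1" "degree p \<le> n"
    and bnd: "\<And>y. y \<in> {a..b} \<Longrightarrow> \<bar>poly p y\<bar> \<le> B" and x: "x \<in> {a..b}"
  shows "\<bar>poly (pderiv p) x\<bar> \<le> 4 / (b - a) * (B * (real n)\<^sup>2)"
    and "\<bar>poly (pderiv (pderiv p)) x\<bar>
           \<le> 16 / (b - a)\<^sup>2 * (B * ((real n)\<^sup>2 * ((real n)\<^sup>2 - 1) / 3))"
proof -
  define c where "c = (if x \<le> (a + b) / 2 then b else a)"
  have c: "(b - a) / 2 \<le> \<bar>x - c\<bar>" "c \<noteq> x" "c \<in> {a..b}"
    using ab x by (auto simp: c_def field_simps)
  have seg: "\<bar>poly p y\<bar> \<le> B" if "y \<in> closed_segment c x" for y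
    using that c(3) x closed_segment_subset[of c "{a..b}" x] by (intro bnd) auto
  have B: "0 \<le> B" using bnd[OF x] by linarith
  have r: "2 / \<bar>x - c\<bar> \<le> 4 / (b - a)"
    using c ab by (simp add: field_simps)
  have "2 / \<bar>x - c\<bar> * (B * (real n)\<^sup>2) \<le> 4 / (b - a) * (B * (real n)\<^sup>2)"
    using B by (intro mult_right_mono r) auto
  then show "\<bar>poly (pderiv p) x\<bar> \<le> 4 / (b - a) * (B * (real n)\<^sup>2)"
    using markov_endpoint(1)[OF n c(2) seg] by linarith
  have "(2 / \<bar>x - c\<bar>)\<^sup>2 \<le> (4 / (b - a))\<^sup>2"
    by (rule power_mono[OF r]) simp
  moreover have "0 \<le> B * ((real n)\<^sup>2 * ((real n)\<^sup>2 - 1) / 3)"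
    using B n(1) by (simp add: one_le_power)
  ultimately have "(2 / \<bar>x - c\<bar>)\<^sup>2 * (B * ((real n)\<^sup>2 * ((real n)\<^sup>2 - 1) / 3))
      \<le> (4 / (b - a))\<^sup>2 * (B * ((real n)\<^sup>2 * ((real n)\<^sup>2 - 1) / 3))"
    by (rule mult_right_mono)
  also have "(4 / (b - a))\<^sup>2 = 16 / (b - a)\<^sup>2" by (simp add: power_divide)
  finally show "\<bar>poly (pderiv (pderiv p)) x\<bar>
           \<le> 16 / (b - a)\<^sup>2 * (B * ((real n)\<^sup>2 * ((real n)\<^sup>2 - 1) / 3))"
    using markov_endpoint(2)[OF n c(2) seg] by linarith
qed

text \<open>Markov's inequality would give the constant \<open>2\<close>; the error estimate at the ends of the
  interval tolerates every constant up to \<open>\<pi>\<close>.\<close>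

lemma poly_lipschitz_at_end:
  fixes a b y B :: real
  assumes ab: "a < b" and n: "n \<ge> 1" "degree p \<le> n"
    and bnd: "\<And>y. y \<in> {a..b} \<Longrightarrow> \<bar>poly p y\<bar> \<le> B" and e: "e = a \<or> e = b" and y: "y \<in> {a..b}"
  shows "\<bar>poly p y - poly p e\<bar> \<le> 3 * (real n)\<^sup>2 * B / (b - a) * \<bar>y - e\<bar>"
proof (cases "n \<ge> 2 \<and> (b - a) / 3 \<le> \<bar>y - e\<bar>")
  \<comment> \<open>Far from e the trivial bound 2B suffices: beyond one third of the interval the
    Lipschitz term is at least n^2 B, and n^2 >= 4.\<close>
  case True
  have B: "0 \<le> B" using bnd[OF y] by linarith
  have "\<bar>poly p y - poly p e\<bar> \<le> 2 * B"
    using bnd[OF y] bnd[of e] e ab by auto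
  also have "\<dots> \<le> 3 * (real n)\<^sup>2 * B / (b - a) * ((b - a) / 3)"
  proof -
    have "2 * 2 \<le> (real n)\<^sup>2" using True power_mono[of 2 "real n" 2] by simp
    then have "2 * B \<le> (real n)\<^sup>2 * B" using B by (intro mult_right_mono) auto
    then show ?thesis using ab by simp
  qed
  also have "\<dots> \<le> 3 * (real n)\<^sup>2 * B / (b - a) * \<bar>y - e\<bar>"
    using True ab B by (intro mult_left_mono) auto
  finally show ?thesis .
next
  case False
  \<comment> \<open>The opposite end. If y is in the third next to e, all points between e and y are
    at least 2/3 (b - a) away from c, so the endpoint inequality has the constant 2/(2/3) = 3. For n
    = 1 the derivative is constant and its bound at e serves everywhere.\<close>
  define c where "c = a + b - e"
  have c: "c \<in> {a..b}" "e \<in> {a..b}" "\<bar>e - c\<bar> = b - a" "c \<noteq> e" using e ab by (auto simp: c_def)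
  have B: "0 \<le> B" using bnd[OF y] by linarith
  have seg: "\<bar>poly p z\<bar> \<le> B" if "z \<in> closed_segment c x" "x \<in> {a..b}" for x z
    using that c(1) closed_segment_subset[of c "{a..b}" x] by (intro bnd) auto
  have der: "\<bar>poly (pderiv p) \<xi>\<bar> \<le> 3 * (real n)\<^sup>2 * B / (b - a)" if \<xi>: "\<xi> \<in> closed_segment e y" for \<xi>
  proof (cases "n = 1")
    case True
    then have "degree (pderiv p) = 0" using n(2) by (simp add: degree_pderiv)
    then obtain k where "pderiv p = [:k:]" by (metis degree_eq_zeroE)
    then have "poly (pderiv p) \<xi> = poly (pderiv p) e" by simp
    also have "\<bar>\<dots>\<bar> \<le> 2 / (b - a) * (B * (real n)\<^sup>2)"
      using markov_endpoint(1)[OF n c(4) seg[OF _ c(2)]] c(3) by simp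
    also have "\<dots> \<le> 3 * (real n)\<^sup>2 * B / (b - a)"
      using B ab by (simp add: divide_right_mono mult_right_mono)
    finally show ?thesis .
  next
    case False
    then have "\<bar>y - e\<bar> \<le> (b - a) / 3" using \<open>\<not> (n \<ge> 2 \<and> _)\<close> n(1) by linarith
    then have "\<bar>\<xi> - e\<bar> \<le> (b - a) / 3"
      using \<xi> by (auto simp: closed_segment_eq_real_ivl split: if_splits)
    then have d: "2 / 3 * (b - a) \<le> \<bar>\<xi> - c\<bar>"
      using c(3) abs_triangle_ineq[of "e - \<xi>" "\<xi> - c"] abs_minus_commute[of e \<xi>] by simp
    have \<xi>ab: "\<xi> \<in> {a..b}" using \<xi> c(2) y closed_segment_subset[of e "{a..b}" y] by auto
    have "c \<noteq> \<xi>" using d ab by auto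
    then have "\<bar>poly (pderiv p) \<xi>\<bar> \<le> 2 / \<bar>\<xi> - c\<bar> * (B * (real n)\<^sup>2)"
      by (rule markov_endpoint(1)[OF n _ seg[OF _ \<xi>ab]])
    also have "\<dots> \<le> 3 / (b - a) * (B * (real n)\<^sup>2)"
    proof (rule mult_right_mono)
      have "2 / \<bar>\<xi> - c\<bar> \<le> 2 / (2 / 3 * (b - a))"
        by (rule frac_le) (use d ab in auto)
      also have "\<dots> = 3 / (b - a)" using ab by (simp add: field_simps)
      finally show "2 / \<bar>\<xi> - c\<bar> \<le> 3 / (b - a)" .
    qed (use B in auto)
    finally show ?thesis by (simp add: mult_ac)
  qed
  have "norm (poly p y - poly p e) \<le> 3 * (real n)\<^sup>2 * B / (b - a) * norm (y - e)"
    by (rule field_differentiable_bound[where S = "closed_segment e y" and f' = "poly (pderiv p)"])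
      (use der in \<open>auto intro: DERIV_subset poly_DERIV\<close>)
  then show ?thesis by simp
qed

section \<open>Second differences of a polynomial along the cosine\<close>

lemma cos_chord_le: "(cos (\<theta> + s) - cos \<theta>)\<^sup>2 \<le> 2 * (1 - cos (s :: real))"
proof -
  define x \<sigma> c z where "x = cos \<theta>" and "\<sigma> = sin \<theta>" and "c = cos s" and "z = sin s"
  have 1: "x\<^sup>2 + \<sigma>\<^sup>2 = 1" "c\<^sup>2 + z\<^sup>2 = 1" by (simp_all add: x_def \<sigma>_def c_def z_def)
  \<comment> \<open>The two squares are those of the real and the imaginary part of
    e^(i(\<theta>+s)) - e^(i\<theta>), a chord of squared length 2 - 2 cos s.\<close>
  have "(x * (c - 1) - \<sigma> * z)\<^sup>2 + (x * z + \<sigma> * (c - 1))\<^sup>2 = (x\<^sup>2 + \<sigma>\<^sup>2) * ((c\<^sup>2 + z\<^sup>2) + 1 - 2 * c)"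
    by (simp add: power2_eq_square algebra_simps)
  then have "(x * (c - 1) - \<sigma> * z)\<^sup>2 + (x * z + \<sigma> * (c - 1))\<^sup>2 = 2 - 2 * c"
    unfolding 1 by simp
  then have "(x * (c - 1) - \<sigma> * z)\<^sup>2 \<le> 2 - 2 * c"
    using zero_le_power2[of "x * z + \<sigma> * (c - 1)"] by linarith
  then show ?thesis by (simp add: cos_add x_def \<sigma>_def c_def z_def algebra_simps)
qed

lemma poly_taylor2:
  fixes a b x y D :: real
  assumes bnd: "\<And>t. t \<in> {a..b} \<Longrightarrow> \<bar>poly (pderiv (pderiv p)) t\<bar> \<le> D"
    and "x \<in> {a..b}" "y \<in> {a..b}"
  shows "\<bar>poly p y - poly p x - poly (pderiv p) x * (y - x)\<bar> \<le> D / 2 * (y - x)\<^sup>2"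
proof (cases "x = y")
  case False
  have "\<exists>t. (if y < x then y < t \<and> t < x else x < t \<and> t < y) \<and>
      poly p y = (\<Sum>m<2. poly ((pderiv ^^ m) p) x / fact m * (y - x) ^ m)
        + poly ((pderiv ^^ 2) p) t / fact 2 * (y - x) ^ 2"
    by (rule Taylor[where a = a and b = b]) (use assms False in auto)
  then obtain t where t: "if y < x then y < t \<and> t < x else x < t \<and> t < y"
    and eq: "poly p y = poly p x + poly (pderiv p) x * (y - x)
               + poly (pderiv (pderiv p)) t / 2 * (y - x)\<^sup>2"
    by (auto simp: numeral_2_eq_2)
  have "t \<in> {a..b}" using t assms by (auto split: if_splits)
  have "\<bar>poly p y - poly p x - poly (pderiv p) x * (y - x)\<bar>
      = \<bar>poly (pderiv (pderiv p)) t\<bar> / 2 * (y - x)\<^sup>2"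
    unfolding eq by (simp add: abs_mult)
  also have "\<dots> \<le> D / 2 * (y - x)\<^sup>2"
    using bnd[OF \<open>t \<in> {a..b}\<close>] by (intro mult_right_mono) auto
  finally show ?thesis .
qed simp

text \<open>The shifts by s and -s cancel the first-order term up to -2 cos \<theta> (1 - cos s),
  and the two squared chords are bounded by multiples of 1 - cos s as well. Hence the first and
  second derivative enter on an equal footing.\<close>

lemma poly_cos_second_difference:
  fixes a b \<theta> s B :: real
  assumes ab: "a < b" "b - a \<le> 2" and n: "n \<ge> 1" "degree p \<le> n"
    and bnd: "\<And>y. y \<in> {a..b} \<Longrightarrow> \<bar>poly p y\<bar> \<le> B"
    and mem: "cos \<theta> \<in> {a..b}" "cos (\<theta> + s) \<in> {a..b}" "cos (\<theta> - s) \<in> {a..b}"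
  shows "\<bar>(poly p (cos (\<theta> + s)) + poly p (cos (\<theta> - s))) / 2 - poly p (cos \<theta>)\<bar>
           \<le> pi\<^sup>2 * real n ^ 4 * B / (b - a)\<^sup>2 * (1 - cos s)"
proof -
  define x y z u w N where "x = cos \<theta>" and "y = cos (\<theta> + s)" and "z = cos (\<theta> - s)"
    and "u = 1 - cos s" and "w = b - a" and "N = (real n)\<^sup>2"
  have B: "0 \<le> B" using bnd[OF mem(1)] by linarith
  have w: "0 < w" "w \<le> 2" using ab by (auto simp: w_def)
  have N: "1 \<le> N" using n(1) by (simp add: N_def one_le_power)
  have u: "0 \<le> u" by (simp add: u_def)
  define D1 D2 where "D1 = 4 / w * (B * N)" and "D2 = 16 / w\<^sup>2 * (B * (N * (N - 1) / 3))"
  have D1: "\<bar>poly (pderiv p) x\<bar> \<le> D1"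
    unfolding D1_def w_def N_def by (rule markov_interval(1)[OF ab(1) n bnd]) (use mem in \<open>auto simp: x_def\<close>)
  have D2: "\<bar>poly (pderiv (pderiv p)) t\<bar> \<le> D2" if "t \<in> {a..b}" for t
    unfolding D2_def w_def N_def by (rule markov_interval(2)[OF ab(1) n bnd that])
  have D2nn: "0 \<le> D2" using D2[OF mem(1)] by linarith
  have ty: "\<bar>poly p y - poly p x - poly (pderiv p) x * (y - x)\<bar> \<le> D2 / 2 * (y - x)\<^sup>2"
    by (rule poly_taylor2[OF D2]) (use mem in \<open>auto simp: x_def y_def\<close>)
  have tz: "\<bar>poly p z - poly p x - poly (pderiv p) x * (z - x)\<bar> \<le> D2 / 2 * (z - x)\<^sup>2"
    by (rule poly_taylor2[OF D2]) (use mem in \<open>auto simp: x_def z_def\<close>)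
  have mid: "(y - x) + (z - x) = - 2 * x * u"
    by (simp add: x_def y_def z_def u_def cos_add cos_diff algebra_simps)
  have sq: "(y - x)\<^sup>2 + (z - x)\<^sup>2 \<le> 4 * u"
    using cos_chord_le[of \<theta> s] cos_chord_le[of \<theta> "- s"] by (simp add: x_def y_def z_def u_def)
  have "\<bar>poly (pderiv p) x * ((y - x) + (z - x))\<bar> = \<bar>poly (pderiv p) x\<bar> * (2 * \<bar>x\<bar> * u)"
    unfolding mid using u by (simp add: abs_mult)
  also have "\<dots> \<le> D1 * (2 * 1 * u)"
    using D1 u by (intro mult_mono) (auto simp: x_def mult_right_mono)
  finally have lin: "\<bar>poly (pderiv p) x * ((y - x) + (z - x))\<bar> \<le> 2 * D1 * u" by simp
  have "D2 / 2 * (y - x)\<^sup>2 + D2 / 2 * (z - x)\<^sup>2 = D2 / 2 * ((y - x)\<^sup>2 + (z - x)\<^sup>2)"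
    by (simp add: algebra_simps)
  also have "\<dots> \<le> D2 / 2 * (4 * u)"
    using sq D2nn by (intro mult_left_mono) auto
  finally have quad: "D2 / 2 * (y - x)\<^sup>2 + D2 / 2 * (z - x)\<^sup>2 \<le> 2 * D2 * u" by simp
  have "\<bar>(poly p y + poly p z) / 2 - poly p x\<bar> \<le> (D1 + D2) * u"
  proof -
    define R S L where "R = poly p y - poly p x - poly (pderiv p) x * (y - x)"
      and "S = poly p z - poly p x - poly (pderiv p) x * (z - x)"
      and "L = poly (pderiv p) x * ((y - x) + (z - x))"
    have eq: "(poly p y + poly p z) / 2 - poly p x = (R + S + L) / 2"
      by (simp add: R_def S_def L_def algebra_simps)
    have "\<bar>R + S + L\<bar> \<le> 2 * (D1 * u) + 2 * (D2 * u)"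
      using ty tz lin quad unfolding R_def[symmetric] S_def[symmetric] L_def[symmetric] mult.assoc
      by linarith
    then show ?thesis unfolding eq by (simp add: distrib_right)
  qed
  also have "\<dots> \<le> pi\<^sup>2 * real n ^ 4 * B / w\<^sup>2 * u"
  proof (rule mult_right_mono[OF _ u])
    \<comment> \<open>The length w is at most 2, so 4/w <= 8/w^2 and both derivative bounds get the
      same denominator. Their sum has the factor 8 + 16(N-1)/3, which lies below 9N and thus below
      pi^2 N.\<close>
    have "4 / w * (B * N) \<le> 8 / w\<^sup>2 * (B * N)"
      using w B N by (intro mult_right_mono) (auto simp: field_simps power2_eq_square)
    then have "D1 + D2 \<le> 8 / w\<^sup>2 * (B * N) + 16 / w\<^sup>2 * (B * (N * (N - 1) / 3))"
      by (simp add: D1_def D2_def)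
    also have "\<dots> = (8 + 16 * (N - 1) / 3) * (B * N / w\<^sup>2)"
      using w by (simp add: field_simps)
    also have "\<dots> \<le> (pi\<^sup>2 * N) * (B * N / w\<^sup>2)"
    proof (rule mult_right_mono)
      have "9 \<le> pi\<^sup>2" using pi_gt3 power_mono[of 3 pi 2] by simp
      then have "9 * N \<le> pi\<^sup>2 * N" using N by (intro mult_right_mono) auto
      moreover have "8 + 16 * (N - 1) / 3 \<le> 9 * N" using N by (simp add: field_simps)
      ultimately show "8 + 16 * (N - 1) / 3 \<le> pi\<^sup>2 * N" by linarith
    qed (use B N in auto)
    also have "\<dots> = pi\<^sup>2 * real n ^ 4 * B / w\<^sup>2"
      by (simp add: N_def power2_eq_square power4_eq_xxxx)
    finally show "D1 + D2 \<le> pi\<^sup>2 * real n ^ 4 * B / w\<^sup>2" .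
  qed
  finally show ?thesis by (simp add: x_def y_def z_def u_def w_def)
qed

section \<open>The Jackson kernel\<close>

definition jackson_kernel :: "nat \<Rightarrow> real \<Rightarrow> real" where
  "jackson_kernel d s = 1 + 2 * (\<Sum>j=1..d. jackson_factor j d * cos (real j * s))"

lemma sin_jackson_angle_pos: "0 < sin (jackson_angle d)"
  unfolding jackson_angle_def by (rule sin_gt_zero) (auto simp: field_simps intro!: add_pos_nonneg)

lemma jackson_factor_0: "jackson_factor 0 d = 1"
proof -
  have "sin (jackson_angle d) / (real (d + 2) * sin (jackson_angle d)) = 1 / real (d + 2)"
    using sin_jackson_angle_pos[of d] by simp
  then show ?thesis by (simp add: jackson_factor_def)
qed

lemma jackson_factor_1: "jackson_factor (Suc 0) d = cos (jackson_angle d)"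
proof -
  have "sin (2 * jackson_angle d) / (real (d + 2) * sin (jackson_angle d))
      = 2 / real (d + 2) * cos (jackson_angle d)"
    using sin_jackson_angle_pos[of d] by (simp add: sin_double del: of_nat_add)
  then show ?thesis by (simp add: jackson_factor_def algebra_simps)
qed

text \<open>This is cos(2\<alpha>) plus a correction 2 sin(\<alpha>)^2/(d+2) of order (d+2)^-3; the
  correction is what fixes the order of the second moment.\<close>

lemma jackson_factor_2:
  "jackson_factor 2 d = 1 - 2 * (sin (jackson_angle d))\<^sup>2 + 2 * (sin (jackson_angle d))\<^sup>2 / real (d + 2)"
proof -
  define x where "x = jackson_angle d"
  define N where "N = real (d + 2)"
  have N: "N > 0" by (simp add: N_def)
  have s: "sin x > 0" using sin_jackson_angle_pos by (simp add: x_def)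
  have "sin (3 * x) = sin (2 * x + x)" by simp
  also have "\<dots> = 2 * sin x * (cos x)\<^sup>2 + (1 - 2 * (sin x)\<^sup>2) * sin x"
    unfolding sin_add sin_double cos_double_sin by (simp add: power2_eq_square)
  also have "\<dots> = sin x * (3 - 4 * (sin x)\<^sup>2)"
    unfolding cos_squared_eq by (simp add: algebra_simps)
  finally have "sin (3 * x) / (N * sin x) = (3 - 4 * (sin x)\<^sup>2) / N" using s by simp
  then have "jackson_factor 2 d = (3 - 4 * (sin x)\<^sup>2) / N + (1 - 3 / N) * (1 - 2 * (sin x)\<^sup>2)"
    unfolding jackson_factor_def x_def N_def by (simp add: cos_double_sin)
  also have "\<dots> = 1 - 2 * (sin x)\<^sup>2 + 2 * (sin x)\<^sup>2 / N"
    using N by (simp add: field_simps)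
  finally show ?thesis by (simp add: x_def N_def)
qed

text \<open>Product-to-sum turns each term into a constant cosine and a cosine in arithmetic
  progression; multiplied by 2 sin \<alpha>, the latter telescope. Since (d+2)\<alpha> = pi, the
  upper boundary angle is 2pi - (j+1)\<alpha>, so the upper boundary term reproduces the lower one
  instead of adding a new quantity.\<close>

lemma jackson_factor_autocorrelation:
  assumes "j \<le> d"
  defines "f \<equiv> \<lambda>k. sin (real (k + 1) * jackson_angle d)"
  shows "real (d + 2) * jackson_factor j d = 2 * (\<Sum>k\<le>d-j. f k * f (k + j))"
proof -
  define x where "x = jackson_angle d"
  define N where "N = real (d + 2)"
  have N: "N > 0" by (simp add: N_def)
  have s: "sin x > 0" using sin_jackson_angle_pos by (simp add: x_def)
  have Nx: "N * x = pi" by (simp add: N_def x_def jackson_angle_def)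
  have two: "2 * (f k * f (k + j)) = cos (real j * x) - cos (real (2 * k + 2 + j) * x)" for k
  proof -
    have "cos (real (k + j + 1) * x - real (k + 1) * x) - cos (real (k + j + 1) * x + real (k + 1) * x)
        = 2 * (f k * f (k + j))"
      by (simp add: cos_diff cos_add f_def x_def)
    moreover have "real (k + j + 1) * x - real (k + 1) * x = real j * x"
      "real (k + j + 1) * x + real (k + 1) * x = real (2 * k + 2 + j) * x"
      by (simp_all add: algebra_simps)
    ultimately show ?thesis by simp
  qed
  have tele: "2 * sin x * (\<Sum>k\<le>m. cos (real (2 * k + 2 + j) * x))
      = sin (real (2 * m + 3 + j) * x) - sin (real (j + 1) * x)" for m
  proof (induction m)
    case 0
    have "sin (real (2 + j) * x + x) - sin (real (2 + j) * x - x) = 2 * sin x * cos (real (2 + j) * x)"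
      by (simp add: sin_add sin_diff)
    moreover have "real (2 + j) * x + x = real (3 + j) * x" "real (2 + j) * x - x = real (j + 1) * x"
      by (simp_all add: algebra_simps)
    ultimately show ?case by simp
  next
    case (Suc m)
    define y where "y = real (2 * Suc m + 2 + j) * x"
    have "sin (y + x) - sin (y - x) = 2 * sin x * cos y"
      by (simp add: sin_add sin_diff)
    moreover have "y + x = real (2 * Suc m + 3 + j) * x" "y - x = real (2 * m + 3 + j) * x"
      by (simp_all add: y_def algebra_simps)
    ultimately show ?case using Suc by (simp add: distrib_left y_def)
  qed
  have "real (2 * (d - j) + 3 + j) * x = 2 * pi - real (j + 1) * x"
    using assms(1) by (simp add: Nx[symmetric] N_def of_nat_diff algebra_simps)
  then have "sin (real (2 * (d - j) + 3 + j) * x) = - sin (real (j + 1) * x)"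
    by (simp add: sin_diff)
  then have "2 * sin x * (\<Sum>k\<le>d-j. cos (real (2 * k + 2 + j) * x)) = - 2 * sin (real (j + 1) * x)"
    using tele[of "d - j"] by simp
  then have "sin x * (\<Sum>k\<le>d-j. cos (real (2 * k + 2 + j) * x)) = - sin (real (j + 1) * x)"
    by linarith
  then have cs: "(\<Sum>k\<le>d-j. cos (real (2 * k + 2 + j) * x)) = - sin (real (j + 1) * x) / sin x"
    using s by (simp only: eq_divide_eq mult.commute) simp
  have "2 * (\<Sum>k\<le>d-j. f k * f (k + j)) = (\<Sum>k\<le>d-j. cos (real j * x) - cos (real (2 * k + 2 + j) * x))"
    by (simp only: sum_distrib_left two)
  also have "\<dots> = real (d - j + 1) * cos (real j * x) + sin (real (j + 1) * x) / sin x"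
    unfolding sum_subtractf cs by simp
  also have "\<dots> = N * (sin (real (j + 1) * x) / (N * sin x) + (1 - real (j + 1) / N) * cos (real j * x))"
  proof -
    have 1: "real (d - j + 1) = N - real (j + 1)" using assms(1) by (simp add: N_def of_nat_diff)
    have 2: "(N - t) * C + Q / S = N * (Q / (N * S) + (1 - t / N) * C)" if "S > 0" for t C Q S
    proof -
      have "N * (Q / (N * S)) = Q / S" using N that by simp
      moreover have "N * (1 - t / N) = N - t" using N by (simp add: right_diff_distrib)
      ultimately show ?thesis by (simp add: distrib_left flip: mult.assoc)
    qed
    show ?thesis unfolding 1 by (rule 2[OF s])
  qed
  finally show ?thesis by (simp add: jackson_factor_def x_def N_def)
qed

text \<open>The left side is the squared modulus of the sum of f k e^(iks); on the right its double
  sum is grouped by frequency difference. A cosine sum with autocorrelation coefficients is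
  therefore nonnegative.\<close>

lemma trig_sum_sq_modulus:
  fixes f :: "nat \<Rightarrow> real"
  shows "(\<Sum>k\<le>d. f k * cos (real k * s))\<^sup>2 + (\<Sum>k\<le>d. f k * sin (real k * s))\<^sup>2
    = (\<Sum>k\<le>d. (f k)\<^sup>2) + 2 * (\<Sum>j=1..d. (\<Sum>k\<le>d-j. f k * f (k + j)) * cos (real j * s))"
proof (induction d)
  case 0
  show ?case by (simp add: power_mult_distrib)
next
  case (Suc d)
  define C S where "C = (\<Sum>k\<le>d. f k * cos (real k * s))" and "S = (\<Sum>k\<le>d. f k * sin (real k * s))"
  define F c z where "F = f (Suc d)" and "c = cos (real (Suc d) * s)" and "z = sin (real (Suc d) * s)"
  have "(C + F * c)\<^sup>2 + (S + F * z)\<^sup>2 = C\<^sup>2 + S\<^sup>2 + F\<^sup>2 * (z\<^sup>2 + c\<^sup>2) + 2 * F * (c * C + z * S)"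
    by (simp add: power2_eq_square algebra_simps)
  also have "z\<^sup>2 + c\<^sup>2 = 1" by (simp add: z_def c_def)
  also have "c * C + z * S = (\<Sum>k\<le>d. f k * cos (real (Suc d - k) * s))"
    unfolding C_def S_def sum_distrib_left sum.distrib[symmetric]
  proof (rule sum.cong[OF refl])
    fix k assume "k \<in> {..d}"
    then have "real (Suc d - k) * s = real (Suc d) * s - real k * s"
      by (simp add: of_nat_diff algebra_simps)
    then have "cos (real (Suc d - k) * s) = c * cos (real k * s) + z * sin (real k * s)"
      by (simp only: cos_diff c_def z_def)
    then show "c * (f k * cos (real k * s)) + z * (f k * sin (real k * s)) = f k * cos (real (Suc d - k) * s)"
      by (simp add: algebra_simps)
  qed
  also have "\<dots> = (\<Sum>j=1..Suc d. f (Suc d - j) * cos (real j * s))"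
    by (rule sum.reindex_bij_witness[of _ "\<lambda>j. Suc d - j" "\<lambda>k. Suc d - k"]) auto
  finally have step: "(C + F * c)\<^sup>2 + (S + F * z)\<^sup>2 = C\<^sup>2 + S\<^sup>2 + F\<^sup>2
      + 2 * F * (\<Sum>j=1..Suc d. f (Suc d - j) * cos (real j * s))" by simp
  have "(\<Sum>k\<le>Suc d - j. f k * f (k + j)) = (\<Sum>k\<le>d-j. f k * f (k + j)) + F * f (Suc d - j)"
    if "j \<in> {1..d}" for j
    using that by (simp add: Suc_diff_le F_def mult.commute)
  then have "(\<Sum>j=1..Suc d. (\<Sum>k\<le>Suc d - j. f k * f (k + j)) * cos (real j * s))
      = (\<Sum>j=1..d. ((\<Sum>k\<le>d-j. f k * f (k + j)) + F * f (Suc d - j)) * cos (real j * s)) + f 0 * F * c"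
    by (simp add: F_def c_def)
  also have "\<dots> = (\<Sum>j=1..d. (\<Sum>k\<le>d-j. f k * f (k + j)) * cos (real j * s))
      + F * (\<Sum>j=1..Suc d. f (Suc d - j) * cos (real j * s))"
    by (simp add: distrib_right sum.distrib sum_distrib_left distrib_left c_def mult_ac)
  finally have rhs: "(\<Sum>j=1..Suc d. (\<Sum>k\<le>Suc d - j. f k * f (k + j)) * cos (real j * s))
      = (\<Sum>j=1..d. (\<Sum>k\<le>d-j. f k * f (k + j)) * cos (real j * s))
      + F * (\<Sum>j=1..Suc d. f (Suc d - j) * cos (real j * s))" .
  have "(\<Sum>k\<le>Suc d. f k * cos (real k * s))\<^sup>2 + (\<Sum>k\<le>Suc d. f k * sin (real k * s))\<^sup>2
      = (C + F * c)\<^sup>2 + (S + F * z)\<^sup>2"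
    by (simp add: C_def S_def F_def c_def z_def)
  also have "\<dots> = (\<Sum>k\<le>d. (f k)\<^sup>2) + 2 * (\<Sum>j=1..d. (\<Sum>k\<le>d-j. f k * f (k + j)) * cos (real j * s))
      + F\<^sup>2 + 2 * F * (\<Sum>j=1..Suc d. f (Suc d - j) * cos (real j * s))"
    unfolding step Suc.IH[folded C_def S_def] ..
  finally show ?case unfolding rhs by (simp add: F_def distrib_left)
qed

lemma jackson_kernel_nonneg: "0 \<le> jackson_kernel d s"
proof -
  define f where "f k = sin (real (k + 1) * jackson_angle d)" for k
  have ac: "real (d + 2) * jackson_factor j d = 2 * (\<Sum>k\<le>d-j. f k * f (k + j))" if "j \<le> d" for j
    using jackson_factor_autocorrelation[OF that] by (simp add: f_def)
  have "real (d + 2) * jackson_kernel d s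
      = real (d + 2) * jackson_factor 0 d
        + 2 * (\<Sum>j=1..d. (real (d + 2) * jackson_factor j d) * cos (real j * s))"
    by (simp add: jackson_kernel_def jackson_factor_0 distrib_left sum_distrib_left mult_ac)
  also have "(\<Sum>j=1..d. (real (d + 2) * jackson_factor j d) * cos (real j * s))
      = (\<Sum>j=1..d. 2 * ((\<Sum>k\<le>d-j. f k * f (k + j)) * cos (real j * s)))"
    by (rule sum.cong[OF refl]) (use ac in \<open>simp del: of_nat_add\<close>)
  also have "real (d + 2) * jackson_factor 0 d = 2 * (\<Sum>k\<le>d. (f k)\<^sup>2)"
    using ac[of 0] by (simp add: power2_eq_square)
  finally have "real (d + 2) * jackson_kernel d s
      = 2 * ((\<Sum>k\<le>d. f k * cos (real k * s))\<^sup>2 + (\<Sum>k\<le>d. f k * sin (real k * s))\<^sup>2)"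
    unfolding trig_sum_sq_modulus by (simp flip: sum_distrib_left)
  then have "0 \<le> real (d + 2) * jackson_kernel d s" by simp
  then show ?thesis by (simp add: zero_le_mult_iff)
qed

section \<open>Orthogonality and the moments of the kernel\<close>

lemma has_integral_cos_nat:
  "((\<lambda>s. cos (real m * s)) has_integral (if m = 0 then pi else 0)) {0..pi}"
proof (cases "m = 0")
  case True
  then show ?thesis using has_integral_const_real[of "1::real" 0 pi] by simp
next
  case False
  have "((\<lambda>s. cos (real m * s)) has_integral (sin (real m * pi) / real m - sin (real m * 0) / real m)) {0..pi}"
    by (rule fundamental_theorem_of_calculus)
      (use False in \<open>auto intro!: derivative_eq_intros simp flip: has_real_derivative_iff_has_vector_derivative\<close>)
  then show ?thesis using False by simp
qed

lemma continuous_jackson_kernel [continuous_intros]: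
  fixes f :: "real \<Rightarrow> real"
  assumes "continuous_on S f"
  shows "continuous_on S (\<lambda>x. jackson_kernel d (f x))"
  unfolding jackson_kernel_def using assms by (auto intro!: continuous_intros)

lemma has_integral_jackson_kernel_cos:
  assumes "k \<le> d"
  shows "((\<lambda>s. jackson_kernel d s * cos (real k * s)) has_integral pi * jackson_factor k d) {0..pi}"
proof -
  \<comment> \<open>The difference frequency as a natural number; the cosine is even, so the sign
    lost here is immaterial.\<close>
  define h where "h j = nat \<bar>int j - int k\<bar>" for j
  have h0: "h j = 0 \<longleftrightarrow> j = k" for j by (auto simp: h_def)
  have prod: "2 * (cos (real j * s) * cos (real k * s)) = cos (real (j + k) * s) + cos (real (h j) * s)" for j s
  proof -
    have "cos (real (h j) * s) = cos (real j * s - real k * s)"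
    proof (cases "k \<le> j")
      case True
      then have "real (h j) * s = real j * s - real k * s" by (simp add: h_def nat_diff_distrib of_nat_diff algebra_simps)
      then show ?thesis by simp
    next
      case False
      then have "real (h j) * s = - (real j * s - real k * s)" by (simp add: h_def nat_diff_distrib of_nat_diff algebra_simps)
      then show ?thesis by (simp only: cos_minus)
    qed
    then show ?thesis by (simp add: cos_add cos_diff distrib_right)
  qed
  have "((\<lambda>s. cos (real k * s) + (\<Sum>j=1..d. jackson_factor j d * (cos (real (j + k) * s) + cos (real (h j) * s))))
     has_integral ((if k = 0 then pi else 0)
        + (\<Sum>j=1..d. jackson_factor j d * ((if j + k = 0 then pi else 0) + (if h j = 0 then pi else 0))))) {0..pi}"
    by (intro has_integral_add has_integral_sum has_integral_mult_right has_integral_cos_nat) simp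
  also have "(\<lambda>s. cos (real k * s) + (\<Sum>j=1..d. jackson_factor j d * (cos (real (j + k) * s) + cos (real (h j) * s))))
      = (\<lambda>s. jackson_kernel d s * cos (real k * s))"
    by (simp only: prod[symmetric]) (simp add: jackson_kernel_def fun_eq_iff distrib_right distrib_left sum_distrib_left sum_distrib_right mult_ac)
  also have "(\<Sum>j=1..d. jackson_factor j d * ((if j + k = 0 then pi else 0) + (if h j = 0 then pi else 0)))
      = (\<Sum>j=1..d. if j = k then pi * jackson_factor k d else 0)"
    by (rule sum.cong) (auto simp: h0)
  also have "(if k = 0 then pi else 0) + \<dots> = pi * jackson_factor k d"
    using assms by (cases k) (auto simp: jackson_factor_0)
  finally show ?thesis .
qed

lemma one_minus_cos_le: "1 - cos x \<le> (x::real)\<^sup>2 / 2"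
proof -
  have "(sin (x / 2))\<^sup>2 \<le> (x / 2)\<^sup>2"
    using abs_sin_x_le_abs_x[of "x / 2"] by (simp only: abs_le_square_iff)
  then show ?thesis using cos_double_sin[of "x / 2"] by (simp add: power_divide)
qed

text \<open>Both weights are combinations of 1, cos s and cos(2s), so the moments are determined by
  the factors 0, 1 and 2: they equal 1 - cos \<alpha> and (1 - cos \<alpha>)^2 +
  sin(\<alpha>)^2/(d+2). The assumption d >= 2 puts frequency 2 into the kernel.\<close>

lemma jackson_moments:
  assumes d: "d \<ge> 2"
  obtains m1 m2
  where "((\<lambda>s. jackson_kernel d s) has_integral pi) {0..pi}"
    and "((\<lambda>s. jackson_kernel d s * (1 - cos s)) has_integral pi * m1) {0..pi}"
    and "((\<lambda>s. jackson_kernel d s * (1 - cos s)\<^sup>2) has_integral pi * m2) {0..pi}"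
    and "m1 \<le> pi\<^sup>2 / (2 * (real (d + 2))\<^sup>2)"
    and "m2 \<le> 2 * pi\<^sup>2 / real (d + 2) ^ 3"
proof
  define x N where "x = jackson_angle d" and "N = real (d + 2)"
  define K where "K = jackson_kernel d"
  have N: "4 \<le> N" using d by (simp add: N_def)
  have xN: "x = pi / N" by (simp add: x_def N_def jackson_angle_def)
  have I0: "(K has_integral pi) {0..pi}"
    using has_integral_jackson_kernel_cos[of 0 d] by (simp add: jackson_factor_0 K_def)
  have I1: "((\<lambda>s. K s * cos s) has_integral pi * cos x) {0..pi}"
    using has_integral_jackson_kernel_cos[of 1 d] d by (simp add: jackson_factor_1 K_def x_def)
  have I2: "((\<lambda>s. K s * cos (2 * s)) has_integral pi * jackson_factor 2 d) {0..pi}"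
    using has_integral_jackson_kernel_cos[of 2 d] d by (simp add: K_def)
  show "((\<lambda>s. jackson_kernel d s) has_integral pi) {0..pi}" using I0 by (simp add: K_def)
  show "((\<lambda>s. jackson_kernel d s * (1 - cos s)) has_integral pi * (1 - cos x)) {0..pi}"
    using has_integral_diff[OF I0 I1] by (simp add: K_def right_diff_distrib)
  have "((\<lambda>s. 3 / 2 * K s - 2 * (K s * cos s) + 1 / 2 * (K s * cos (2 * s))) has_integral
      (3 / 2 * pi - 2 * (pi * cos x) + 1 / 2 * (pi * jackson_factor 2 d))) {0..pi}"
    by (intro has_integral_add has_integral_diff has_integral_mult_right I0 I1 I2)
  also have "(\<lambda>s. 3 / 2 * K s - 2 * (K s * cos s) + 1 / 2 * (K s * cos (2 * s)))
      = (\<lambda>s. jackson_kernel d s * (1 - cos s)\<^sup>2)"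
    unfolding K_def cos_double_cos by (simp add: fun_eq_iff power2_eq_square field_simps)
  also have "3 / 2 * pi - 2 * (pi * cos x) + 1 / 2 * (pi * jackson_factor 2 d)
      = pi * ((1 - cos x)\<^sup>2 + (sin x)\<^sup>2 / N)"
  proof -
    have sq: "(1 - cos x)\<^sup>2 = 2 - 2 * cos x - (sin x)\<^sup>2"
      using sin_cos_squared_add[of x] by (simp add: power2_eq_square algebra_simps)
    show ?thesis
      unfolding jackson_factor_2 x_def[symmetric] N_def[symmetric] sq by (simp add: algebra_simps)
  qed
  finally show "((\<lambda>s. jackson_kernel d s * (1 - cos s)\<^sup>2) has_integral
      pi * ((1 - cos x)\<^sup>2 + (sin x)\<^sup>2 / N)) {0..pi}" .
  have c: "1 - cos x \<le> x\<^sup>2 / 2" by (rule one_minus_cos_le)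
  then show "1 - cos x \<le> pi\<^sup>2 / (2 * (real (d + 2))\<^sup>2)"
    by (simp add: xN N_def power_divide)
  \<comment> \<open>This part is even of order N^-4; the surplus factor pi^2/(4N) is at most 1
    because pi < 4 <= N.\<close>
  have "(1 - cos x)\<^sup>2 \<le> (x\<^sup>2 / 2)\<^sup>2"
    by (rule power_mono[OF c]) simp
  also have "\<dots> = pi\<^sup>2 / N ^ 3 * (pi\<^sup>2 / (4 * N))"
    by (simp add: xN power_divide power2_eq_square power3_eq_cube)
  also have "\<dots> \<le> pi\<^sup>2 / N ^ 3 * 1"
  proof (rule mult_left_mono)
    have "pi\<^sup>2 \<le> 4 ^ 2" using pi_less_4 by (intro power_mono) auto
    then show "pi\<^sup>2 / (4 * N) \<le> 1" using N by (simp add: field_simps)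
  qed (use N in simp)
  finally have 1: "(1 - cos x)\<^sup>2 \<le> pi\<^sup>2 / N ^ 3" by simp
  have "(sin x)\<^sup>2 \<le> x\<^sup>2"
    using abs_sin_x_le_abs_x[of x] by (simp only: abs_le_square_iff)
  then have "(sin x)\<^sup>2 / N \<le> x\<^sup>2 / N" using N by (intro divide_right_mono) auto
  also have "\<dots> = pi\<^sup>2 / N ^ 3" by (simp add: xN power_divide power2_eq_square power3_eq_cube)
  finally show "(1 - cos x)\<^sup>2 + (sin x)\<^sup>2 / N \<le> 2 * pi\<^sup>2 / real (d + 2) ^ 3"
    using 1 by (simp add: N_def)
qed

section \<open>Chebyshev--Jackson series as kernel means\<close>

definition cutoff :: "real \<Rightarrow> real \<Rightarrow> real poly \<Rightarrow> real \<Rightarrow> real" where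
  "cutoff a b p y = (if a \<le> y \<and> y \<le> b then poly p y else 0)"

lemma cutoff_bounded: "\<exists>B. \<forall>y. \<bar>cutoff a b p y\<bar> \<le> B"
proof -
  have "bounded (poly p ` {a..b})"
    by (intro compact_imp_bounded compact_continuous_image continuous_intros) auto
  then obtain B where "\<forall>y\<in>{a..b}. \<bar>poly p y\<bar> \<le> B"
    by (auto simp: bounded_iff)
  then have "\<bar>cutoff a b p y\<bar> \<le> max B 0" for y
    by (auto simp: cutoff_def le_max_iff_disj)
  then show ?thesis by blast
qed

lemma borel_measurable_cutoff [measurable]: "cutoff a b p \<in> borel_measurable borel"
proof -
  have [measurable]: "poly p \<in> borel_measurable borel"
    by (intro borel_measurable_continuous_onI continuous_intros)
  show ?thesis unfolding cutoff_def[abs_def] by measurable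
qed

text \<open>The jumps of the cut-off along g need not be located: measurability and a continuous
  majorant give integrability.\<close>

lemma cutoff_times_integrable:
  fixes g f :: "real \<Rightarrow> real"
  assumes g: "continuous_on UNIV g" and f: "continuous_on UNIV f"
  shows "(\<lambda>s. cutoff a b p (g s) * f s) integrable_on {x..y}"
proof -
  obtain B where B: "\<And>y. \<bar>cutoff a b p y\<bar> \<le> B" using cutoff_bounded by blast
  have [measurable]: "g \<in> borel_measurable borel" "f \<in> borel_measurable borel"
    using g f by (simp_all add: borel_measurable_continuous_onI)
  show ?thesis
  proof (rule measurable_bounded_by_integrable_imp_integrable_real[where g = "\<lambda>s. B * \<bar>f s\<bar>"])
    have "(\<lambda>s. cutoff a b p (g s) * f s) \<in> borel_measurable borel" by measurable
    then show "(\<lambda>s. cutoff a b p (g s) * f s) \<in> borel_measurable (lebesgue_on {x..y})"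
      by (intro measurable_restrict_space1 measurable_completion) simp
    show "(\<lambda>s. B * \<bar>f s\<bar>) integrable_on {x..y}"
      by (intro integrable_continuous_real continuous_intros continuous_on_subset[OF f]) auto
    show "\<bar>cutoff a b p (g s) * f s\<bar> \<le> B * \<bar>f s\<bar>" for s
      using B[of "g s"] by (simp add: abs_mult mult_right_mono)
  qed simp
qed

text \<open>Substitution t = cos \<phi>, with -1 and 1 as exceptional points where arccos is not
  differentiable. As arccos reverses orientation, only the integral with the negative sign survives.
  Integrability of the possibly unbounded integrand is part of the conclusion.\<close>

lemma cheb_weight_has_integral:
  assumes "-1 \<le> a" "a < b" "b \<le> 1"
  shows "((\<lambda>t. poly p t * poly (cheb_T j) t / sqrt (1 - t\<^sup>2)) has_integral
           integral {0..pi} (\<lambda>\<phi>. cutoff a b p (cos \<phi>) * cos (real j * \<phi>))) {a..b}"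
proof -
  define f where "f \<phi> = poly p (cos \<phi>) * cos (real j * \<phi>)" for \<phi>
  define \<alpha> \<beta> where "\<alpha> = arccos a" and "\<beta> = arccos b"
  have ang: "0 \<le> \<beta>" "\<beta> < \<alpha>" "\<alpha> \<le> pi" "cos \<alpha> = a" "cos \<beta> = b"
    using assms by (auto simp: \<alpha>_def \<beta>_def arccos_lbound arccos_ubound arccos_less_mono)
  have cf: "continuous_on S f" for S
    unfolding f_def by (intro continuous_intros)
  have "((\<lambda>t. - inverse (sqrt (1 - t\<^sup>2)) *\<^sub>R f (arccos t)) has_integral
      (integral {arccos a..arccos b} f - integral {arccos b..arccos a} f)) {a..b}"
  proof (rule has_integral_substitution_general[where s = "{-1, 1}" and c = 0 and d = pi])
    show "arccos ` {a..b} \<subseteq> {0..pi}"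
      using assms by (auto simp: arccos_lbound arccos_ubound)
    show "continuous_on {a..b} arccos"
      using assms by (intro continuous_on_subset[OF continuous_on_arccos']) auto
    show "(arccos has_real_derivative - inverse (sqrt (1 - x\<^sup>2))) (at x within {a..b})"
      if "x \<in> {a..b} - {-1, 1}" for x
      using that assms DERIV_arccos[of x] by (auto intro: has_field_derivative_at_within)
  qed (use assms cf in auto)
  then have "((\<lambda>t. - (- inverse (sqrt (1 - t\<^sup>2)) *\<^sub>R f (arccos t))) has_integral
      - (integral {arccos a..arccos b} f - integral {arccos b..arccos a} f)) {a..b}"
    by (rule has_integral_neg)
  then have "((\<lambda>t. - (- inverse (sqrt (1 - t\<^sup>2)) *\<^sub>R f (arccos t))) has_integral
      integral {\<beta>..\<alpha>} f) {a..b}"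
    using ang(2) by (simp add: \<alpha>_def \<beta>_def)
  then have "((\<lambda>t. poly p t * poly (cheb_T j) t / sqrt (1 - t\<^sup>2)) has_integral integral {\<beta>..\<alpha>} f) {a..b}"
  proof (rule has_integral_eq[rotated])
    fix t assume "t \<in> {a..b}"
    then have "cos (arccos t) = t" using assms by simp
    then show "- (- inverse (sqrt (1 - t\<^sup>2)) *\<^sub>R f (arccos t)) = poly p t * poly (cheb_T j) t / sqrt (1 - t\<^sup>2)"
      using poly_cheb_T_cos[of j "arccos t"] by (simp add: f_def divide_inverse)
  qed
  moreover have "integral {0..pi} (\<lambda>\<phi>. cutoff a b p (cos \<phi>) * cos (real j * \<phi>)) = integral {\<beta>..\<alpha>} f"
  proof (rule integral_unique)
    have "(f has_integral integral {\<beta>..\<alpha>} f) {\<beta>..\<alpha>}"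
      by (intro integrable_integral integrable_continuous_real cf)
    then have "((\<lambda>\<phi>. if \<phi> \<in> {\<beta>..\<alpha>} then f \<phi> else 0) has_integral integral {\<beta>..\<alpha>} f) {0..pi}"
      using ang by (subst has_integral_restrict) auto
    then show "((\<lambda>\<phi>. cutoff a b p (cos \<phi>) * cos (real j * \<phi>)) has_integral integral {\<beta>..\<alpha>} f) {0..pi}"
    proof (rule has_integral_eq[rotated])
      fix \<phi> assume \<phi>: "\<phi> \<in> {0..pi}"
      have "cos \<alpha> \<le> cos \<phi> \<longleftrightarrow> \<phi> \<le> \<alpha>" "cos \<phi> \<le> cos \<beta> \<longleftrightarrow> \<beta> \<le> \<phi>"
        using \<phi> ang cos_mono_le_eq[of \<alpha> \<phi>] cos_mono_le_eq[of \<phi> \<beta>] by auto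
      then show "(if \<phi> \<in> {\<beta>..\<alpha>} then f \<phi> else 0) = cutoff a b p (cos \<phi>) * cos (real j * \<phi>)"
        using ang by (auto simp: cutoff_def f_def)
    qed
  qed
  ultimately show ?thesis by simp
qed

section \<open>From Fourier coefficients to a convolution\<close>

lemma integral_symmetric_fold:
  fixes f :: "real \<Rightarrow> real"
  assumes f: "f integrable_on {-c..c}" and "0 \<le> c"
  shows "integral {-c..c} f = integral {0..c} (\<lambda>s. f s + f (- s))"
proof -
  have sub: "f integrable_on {0..c}" "f integrable_on {-c..0}"
    using assms by (auto intro: integrable_subinterval_real[OF f])
  have "(\<lambda>s. f (- s)) integrable_on {0..c}"
    using sub(2) Henstock_Kurzweil_Integration.integrable_reflect_real[where f = f and a = "-c" and b = 0]
    by simp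
  moreover have "integral {-c..0} f = integral {0..c} (\<lambda>s. f (- s))"
    using Henstock_Kurzweil_Integration.integral_reflect_real[where a = 0 and b = c and f = "\<lambda>s. f (- s)"]
    by simp
  moreover have "integral {-c..0} f + integral {0..c} f = integral {-c..c} f"
    using assms by (intro Henstock_Kurzweil_Integration.integral_combine) auto
  ultimately show ?thesis using sub by (simp add: Henstock_Kurzweil_Integration.integral_add)
qed

lemma integral_periodic_shift:
  fixes f :: "real \<Rightarrow> real"
  assumes f: "\<And>x y. f integrable_on {x..y}" and per: "\<And>s. f (s + 2 * c) = f s"
    and "0 \<le> \<theta>" "\<theta> \<le> c"
  shows "integral {-c..c} (\<lambda>s. f (\<theta> + s)) = integral {-c..c} f"
proof -
  have "integral {-c..c} (\<lambda>s. f (\<theta> + s)) = integral {-c+\<theta>..c+\<theta>} f"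
    using integral_shift_Icc_real[of "-c" c f \<theta>] by (simp add: o_def)
  also have "\<dots> = integral {-c+\<theta>..c} f + integral {c..c+\<theta>} f"
    using assms by (intro Henstock_Kurzweil_Integration.integral_combine[symmetric]) auto
  also have "integral {c..c+\<theta>} f = integral {-c..-c+\<theta>} (\<lambda>s. f (2 * c + s))"
    using integral_shift_Icc_real[of "-c" "-c+\<theta>" f "2 * c"] by (simp add: o_def)
  also have "\<dots> = integral {-c..-c+\<theta>} f"
    by (simp add: per add.commute)
  also have "integral {-c+\<theta>..c} f + integral {-c..-c+\<theta>} f = integral {-c..c} f"
    using assms Henstock_Kurzweil_Integration.integral_combine[of "-c" "-c+\<theta>" c f] by simp
  finally show ?thesis .
qed

text \<open>The kernel is even, so the convolution over a full period folds to an integral over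
  {0..pi} of this average; the cancellation between the two shifts is then visible
  pointwise.\<close>

definition cutoff_mean :: "real \<Rightarrow> real \<Rightarrow> real poly \<Rightarrow> real \<Rightarrow> real \<Rightarrow> real" where
  "cutoff_mean a b p \<theta> s = (cutoff a b p (cos (\<theta> + s)) + cutoff a b p (cos (\<theta> - s))) / 2"

lemma cutoff_mean_integrable:
  assumes "continuous_on UNIV f"
  shows "(\<lambda>s. cutoff_mean a b p \<theta> s * f s) integrable_on {x..y}"
proof -
  have "(\<lambda>s. (cutoff a b p (cos (\<theta> + s)) * f s + cutoff a b p (cos (\<theta> - s)) * f s) / 2) integrable_on {x..y}"
    by (intro integrable_on_divide integrable_add cutoff_times_integrable continuous_intros assms)
  then show ?thesis by (simp add: cutoff_mean_def distrib_right)
qed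

text \<open>Unfold to a full period, shift by \<theta>, fold back: the sine part of cos(j(\<phi> -
  \<theta>)) is odd and disappears against the even cut-off, leaving the factor
  cos(j\<theta>).\<close>

lemma integral_cutoff_mean_cos:
  assumes "0 \<le> \<theta>" "\<theta> \<le> pi"
  shows "integral {0..pi} (\<lambda>s. cutoff_mean a b p \<theta> s * cos (real j * s))
    = cos (real j * \<theta>) * integral {0..pi} (\<lambda>\<phi>. cutoff a b p (cos \<phi>) * cos (real j * \<phi>))"
proof -
  define h where "h = cutoff a b p"
  define k where "k s = h (cos (\<theta> + s)) * cos (real j * s)" for s
  define G where "G \<phi> = h (cos \<phi>) * cos (real j * (\<phi> - \<theta>))" for \<phi>
  have kI: "k integrable_on {x..y}" for x y
    unfolding k_def h_def by (intro cutoff_times_integrable continuous_intros)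
  have GI: "G integrable_on {x..y}" for x y
    unfolding G_def h_def by (intro cutoff_times_integrable continuous_intros)
  have per: "G (s + 2 * pi) = G s" for s
  proof -
    have "real j * (s + 2 * pi - \<theta>) = real j * (s - \<theta>) + 2 * pi * real j" by (simp add: algebra_simps)
    then have "cos (real j * (s + 2 * pi - \<theta>)) = cos (real j * (s - \<theta>))"
      using cos_int_2pin[of "int j"] sin_int_2pin[of "int j"] by (simp only: cos_add) (simp add: mult.commute)
    then show ?thesis by (simp add: G_def)
  qed
  have "2 * integral {0..pi} (\<lambda>s. cutoff_mean a b p \<theta> s * cos (real j * s))
      = integral {0..pi} (\<lambda>s. 2 * (cutoff_mean a b p \<theta> s * cos (real j * s)))" by simp
  also have "(\<lambda>s. 2 * (cutoff_mean a b p \<theta> s * cos (real j * s))) = (\<lambda>s. k s + k (- s))"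
    by (simp add: fun_eq_iff cutoff_mean_def k_def h_def distrib_right)
  also have "integral {0..pi} \<dots> = integral {-pi..pi} k"
    by (rule integral_symmetric_fold[symmetric]) (use kI in auto)
  also have "k = (\<lambda>s. G (\<theta> + s))" by (simp add: fun_eq_iff k_def G_def)
  also have "integral {-pi..pi} (\<lambda>s. G (\<theta> + s)) = integral {-pi..pi} G"
    by (rule integral_periodic_shift[OF GI per assms])
  also have "\<dots> = integral {0..pi} (\<lambda>s. G s + G (- s))"
    by (rule integral_symmetric_fold) (use GI in auto)
  also have "(\<lambda>s. G s + G (- s)) = (\<lambda>s. (2 * cos (real j * \<theta>)) * (h (cos s) * cos (real j * s)))"
  proof
    fix s
    have "cos (real j * (s - \<theta>)) + cos (real j * (- s - \<theta>)) = 2 * cos (real j * \<theta>) * cos (real j * s)"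
      by (simp add: right_diff_distrib cos_diff)
    then show "G s + G (- s) = (2 * cos (real j * \<theta>)) * (h (cos s) * cos (real j * s))"
      by (simp add: G_def flip: distrib_left)
  qed
  also have "integral {0..pi} \<dots> = 2 * cos (real j * \<theta>) * integral {0..pi} (\<lambda>s. h (cos s) * cos (real j * s))"
    by simp
  finally show ?thesis by (simp add: h_def)
qed

lemma CJ_series_eq_kernel_integral:
  assumes ab: "-1 \<le> a" "a < b" "b \<le> 1" and \<theta>: "0 \<le> \<theta>" "\<theta> \<le> pi"
  shows "pi * poly (CJ_series a b d p) (cos \<theta>)
    = integral {0..pi} (\<lambda>s. cutoff_mean a b p \<theta> s * jackson_kernel d s)"
proof -
  define I where "I j = integral {0..pi} (\<lambda>s. cutoff_mean a b p \<theta> s * cos (real j * s))" for j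
  have has: "((\<lambda>s. cutoff_mean a b p \<theta> s * cos (real j * s)) has_integral I j) {0..pi}" for j
    unfolding I_def by (intro integrable_integral cutoff_mean_integrable continuous_intros)
  have coeff: "pi * cheb_coeff a b p j * cos (real j * \<theta>) = 2 * I j" for j
    using integral_unique[OF cheb_weight_has_integral[OF ab, of p j]] integral_cutoff_mean_cos[OF \<theta>, of a b p j]
    by (simp add: cheb_coeff_def I_def)
  have "pi * poly (CJ_series a b d p) (cos \<theta>)
      = pi * cheb_coeff a b p 0 * cos (real 0 * \<theta>) / 2
        + (\<Sum>j=1..d. jackson_factor j d * (pi * cheb_coeff a b p j * cos (real j * \<theta>)))"
    by (simp add: CJ_series_def poly_sum poly_cheb_T_cos distrib_left sum_distrib_left mult_ac)
  also have "\<dots> = I 0 + 2 * (\<Sum>j=1..d. jackson_factor j d * I j)"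
    unfolding coeff by (simp add: sum_distrib_left mult_ac)
  also have "\<dots> = integral {0..pi} (\<lambda>s. cutoff_mean a b p \<theta> s * jackson_kernel d s)"
  proof (rule integral_unique[symmetric])
    have "((\<lambda>s. cutoff_mean a b p \<theta> s * cos (real 0 * s)
          + 2 * (\<Sum>j=1..d. jackson_factor j d * (cutoff_mean a b p \<theta> s * cos (real j * s))))
        has_integral (I 0 + 2 * (\<Sum>j=1..d. jackson_factor j d * I j))) {0..pi}"
      by (intro has_integral_add has_integral_mult_right has_integral_sum has) simp
    then show "((\<lambda>s. cutoff_mean a b p \<theta> s * jackson_kernel d s)
        has_integral (I 0 + 2 * (\<Sum>j=1..d. jackson_factor j d * I j))) {0..pi}"
      by (simp add: jackson_kernel_def distrib_left sum_distrib_left mult_ac)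
  qed
  finally show ?thesis .
qed

text \<open>The kernel is nonnegative, so a pointwise bound may be integrated against it. The signs
  of c1 and c2 matter as the moments are only bounded above, whereas the total mass is exact. The
  bound is asked for on the open interval because at s = 0 it can fail: for \<theta> at an end, the
  mean there is the full value of p and not half of it.\<close>

lemma CJ_series_error:
  assumes ab: "-1 \<le> a" "a < b" "b \<le> 1" and \<theta>: "0 \<le> \<theta>" "\<theta> \<le> pi" and d: "d \<ge> 2"
    and c: "0 \<le> c1" "0 \<le> c2"
    and bnd: "\<And>s. 0 < s \<Longrightarrow> s < pi \<Longrightarrow>
      \<bar>cutoff_mean a b p \<theta> s - v\<bar> \<le> c0 + c1 * (1 - cos s) + c2 * (1 - cos s)\<^sup>2"
  shows "\<bar>poly (CJ_series a b d p) (cos \<theta>) - v\<bar>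
    \<le> c0 + c1 * (pi\<^sup>2 / (2 * (real (d + 2))\<^sup>2)) + c2 * (2 * pi\<^sup>2 / real (d + 2) ^ 3)"
proof -
  define K where "K = jackson_kernel d"
  obtain m1 m2 where m: "(K has_integral pi) {0..pi}"
    "((\<lambda>s. K s * (1 - cos s)) has_integral pi * m1) {0..pi}"
    "((\<lambda>s. K s * (1 - cos s)\<^sup>2) has_integral pi * m2) {0..pi}"
    "m1 \<le> pi\<^sup>2 / (2 * (real (d + 2))\<^sup>2)" "m2 \<le> 2 * pi\<^sup>2 / real (d + 2) ^ 3"
    unfolding K_def by (rule jackson_moments[OF d])
  define F where "F = poly (CJ_series a b d p) (cos \<theta>)"
  have "((\<lambda>s. cutoff_mean a b p \<theta> s * K s) has_integral pi * F) {0..pi}"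
    unfolding F_def K_def CJ_series_eq_kernel_integral[OF ab \<theta>]
    by (intro integrable_integral cutoff_mean_integrable continuous_intros)
  then have "((\<lambda>s. cutoff_mean a b p \<theta> s * K s - v * K s) has_integral (pi * F - v * pi)) {0..pi}"
    by (intro has_integral_diff has_integral_mult_right m)
  then have L: "((\<lambda>s. (cutoff_mean a b p \<theta> s - v) * K s) has_integral pi * (F - v)) {0<..<pi}"
    unfolding has_integral_Icc_iff_Ioo by (simp add: algebra_simps)
  have "((\<lambda>s. c0 * K s + c1 * (K s * (1 - cos s)) + c2 * (K s * (1 - cos s)\<^sup>2)) has_integral
      (c0 * pi + c1 * (pi * m1) + c2 * (pi * m2))) {0..pi}"
    by (intro has_integral_add has_integral_mult_right m)
  then have R: "((\<lambda>s. (c0 + c1 * (1 - cos s) + c2 * (1 - cos s)\<^sup>2) * K s) has_integral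
      pi * (c0 + c1 * m1 + c2 * m2)) {0<..<pi}"
    unfolding has_integral_Icc_iff_Ioo by (simp add: algebra_simps)
  have "norm (integral {0<..<pi} (\<lambda>s. (cutoff_mean a b p \<theta> s - v) * K s))
      \<le> integral {0<..<pi} (\<lambda>s. (c0 + c1 * (1 - cos s) + c2 * (1 - cos s)\<^sup>2) * K s)"
  proof (rule integral_norm_bound_integral)
    fix s :: real assume "s \<in> {0<..<pi}"
    then show "norm ((cutoff_mean a b p \<theta> s - v) * K s) \<le> (c0 + c1 * (1 - cos s) + c2 * (1 - cos s)\<^sup>2) * K s"
      using bnd[of s] jackson_kernel_nonneg[of d s] by (simp add: K_def abs_mult mult_right_mono)
  qed (use L R in \<open>auto simp: has_integral_integrable\<close>)
  then have "pi * \<bar>F - v\<bar> \<le> pi * (c0 + c1 * m1 + c2 * m2)"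
    unfolding integral_unique[OF L] integral_unique[OF R] by (simp add: abs_mult)
  then have "\<bar>F - v\<bar> \<le> c0 + c1 * m1 + c2 * m2" by simp
  also have "\<dots> \<le> c0 + c1 * (pi\<^sup>2 / (2 * (real (d + 2))\<^sup>2)) + c2 * (2 * pi\<^sup>2 / real (d + 2) ^ 3)"
    using m(4,5) c by (intro add_mono mult_left_mono) auto
  finally show ?thesis by (simp add: F_def)
qed

text \<open>Makes the minimisation a linear problem. Additivity of the coefficients rests on the
  integrability in \<open>cheb_weight_has_integral\<close>.\<close>

lemma CJ_series_linear:
  assumes ab: "-1 \<le> a" "a < b" "b \<le> 1"
  shows CJ_series_add: "CJ_series a b d (p + q) = CJ_series a b d p + CJ_series a b d q"
    and CJ_series_smult: "CJ_series a b d (Polynomial.smult r p) = Polynomial.smult r (CJ_series a b d p)"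
proof -
  have has: "((\<lambda>t. poly p t * poly (cheb_T j) t / sqrt (1 - t\<^sup>2)) has_integral pi / 2 * cheb_coeff a b p j) {a..b}"
    for p j
    unfolding cheb_coeff_def using has_integral_integral[THEN iffD1, OF has_integral_integrable[OF cheb_weight_has_integral[OF ab]]]
    by simp
  have add: "cheb_coeff a b (p + q) j = cheb_coeff a b p j + cheb_coeff a b q j" for j
  proof -
    have "((\<lambda>t. poly (p + q) t * poly (cheb_T j) t / sqrt (1 - t\<^sup>2)) has_integral
        (pi / 2 * cheb_coeff a b p j + pi / 2 * cheb_coeff a b q j)) {a..b}"
      using has_integral_add[OF has[of p j] has[of q j]] by (simp add: distrib_right add_divide_distrib)
    then have "pi / 2 * cheb_coeff a b (p + q) j = pi / 2 * cheb_coeff a b p j + pi / 2 * cheb_coeff a b q j"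
      using has[of "p + q" j] has_integral_unique by blast
    then show ?thesis by (simp flip: distrib_left)
  qed
  have scale: "cheb_coeff a b (Polynomial.smult r p) j = r * cheb_coeff a b p j" for j
  proof -
    have "((\<lambda>t. poly (Polynomial.smult r p) t * poly (cheb_T j) t / sqrt (1 - t\<^sup>2)) has_integral
        r * (pi / 2 * cheb_coeff a b p j)) {a..b}"
      using has_integral_mult_right[OF has[of p j], of r] by (simp add: mult_ac)
    then have "pi / 2 * cheb_coeff a b (Polynomial.smult r p) j = r * (pi / 2 * cheb_coeff a b p j)"
      using has[of "Polynomial.smult r p" j] has_integral_unique by blast
    then show ?thesis by simp
  qed
  show "CJ_series a b d (p + q) = CJ_series a b d p + CJ_series a b d q"
    by (simp add: CJ_series_def add distrib_left smult_add_left sum.distrib add_divide_distrib)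
  show "CJ_series a b d (Polynomial.smult r p) = Polynomial.smult r (CJ_series a b d p)"
    by (simp add: CJ_series_def scale smult_add_right smult_sum2 mult_ac)
qed

section \<open>Pointwise error estimates\<close>

text \<open>Jordan's inequality: the sine is concave, and the line is its chord from 0 to
  pi/2.\<close>

lemma sin_ge_chord:
  assumes "0 \<le> x" "x \<le> pi / 2"
  shows "2 * x / pi \<le> sin (x :: real)"
proof -
  have "convex_on {0..pi} (\<lambda>x :: real. - sin x)"
    by (rule f''_ge0_imp_convex[where f' = "\<lambda>x. - cos x" and f'' = sin])
      (auto intro!: derivative_eq_intros sin_ge_zero)
  from convex_onD[OF this, of "2 * x / pi" 0 "pi / 2"] assms show ?thesis
    by (simp add: field_simps)
qed

text \<open>A Chebyshev-type tail weight: 1 - cos s = 2 sin(s/2)^2 is at least 2s^2/pi^2. The square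
  is taken because the second moment is one order in d smaller than the first; this is the origin of
  \<Delta>^4.\<close>

lemma one_le_tail_weight:
  assumes "0 < \<Delta>" "\<Delta> \<le> s" "s \<le> pi"
  shows "1 \<le> pi ^ 4 / (4 * \<Delta> ^ 4) * (1 - cos s)\<^sup>2"
proof -
  have "s / pi \<le> sin (s / 2)" using sin_ge_chord[of "s / 2"] assms by simp
  then have "(s / pi)\<^sup>2 \<le> (sin (s / 2))\<^sup>2" using assms by (intro power_mono) auto
  then have "2 * (s\<^sup>2 / pi\<^sup>2) \<le> 1 - cos s" using cos_double_sin[of "s / 2"] by (simp add: power_divide)
  then have "2 * s\<^sup>2 \<le> pi\<^sup>2 * (1 - cos s)" by (simp add: field_simps)
  then have "(2 * s\<^sup>2)\<^sup>2 \<le> (pi\<^sup>2 * (1 - cos s))\<^sup>2" by (intro power_mono) auto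
  then have "4 * s ^ 4 \<le> pi ^ 4 * (1 - cos s)\<^sup>2" by (simp add: power_mult_distrib flip: power_mult)
  moreover have "\<Delta> ^ 4 \<le> s ^ 4" using assms by (intro power_mono) auto
  ultimately show ?thesis using assms(1) by (simp add: pos_le_divide_eq)
qed

lemma cos_less_outside:
  assumes "0 \<le> \<alpha>" "\<alpha> < \<phi>" "\<phi> < 2 * pi - \<alpha>"
  shows "cos \<phi> < cos \<alpha>"
proof (cases "\<phi> \<le> pi")
  case True
  then show ?thesis using assms by (intro cos_monotone_0_pi) auto
next
  case False
  have "cos (2 * pi - \<phi>) < cos \<alpha>" using assms False by (intro cos_monotone_0_pi) auto
  then show ?thesis by (simp add: cos_diff)
qed

lemma cos_less_inside:
  assumes "\<beta> \<le> pi" "\<bar>\<phi>\<bar> < \<beta>"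
  shows "cos \<beta> < cos \<phi>"
  using cos_monotone_0_pi[of "\<bar>\<phi>\<bar>" \<beta>] assms by simp

text \<open>Leaving beyond b changes the cosine by more than b - a, so the chord bound applies.
  Leaving below a means that the angle has passed 0 and s > 2 arccos a; then a >= 0 and 2(1 - cos s)
  >= 4(1 - a^2), which exceeds (1 - a)^2 by (1 - a)(3 + 5a) or more.\<close>

lemma leave_interval_from_left_end:
  assumes "-1 \<le> a" "a < b" "b \<le> 1" "0 \<le> s" "s \<le> pi"
    and out: "\<not> (a \<le> cos (arccos a - s) \<and> cos (arccos a - s) \<le> b)"
  shows "(b - a)\<^sup>2 \<le> 2 * (1 - cos s)"
proof -
  define \<alpha> where "\<alpha> = arccos a"
  have \<alpha>: "0 \<le> \<alpha>" "\<alpha> \<le> pi" "cos \<alpha> = a"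
    using assms by (auto simp: \<alpha>_def arccos_lbound arccos_ubound)
  consider "b < cos (\<alpha> - s)" | "cos (\<alpha> - s) < a" using out by (auto simp: \<alpha>_def)
  then show ?thesis
  proof cases
    case 1
    then have "(b - a)\<^sup>2 \<le> (cos (\<alpha> - s) - a)\<^sup>2" using assms(2) by (intro power_mono) auto
    then show ?thesis using cos_chord_le[of \<alpha> "- s"] \<alpha>(3) by simp
  next
    case 2
    have "2 * \<alpha> < s"
    proof (rule ccontr)
      assume "\<not> 2 * \<alpha> < s"
      then have "\<bar>\<alpha> - s\<bar> \<le> \<alpha>" using assms(4) by simp
      then have "cos \<alpha> \<le> cos \<bar>\<alpha> - s\<bar>" using \<alpha> by (intro cos_monotone_0_pi_le) auto
      then show False using 2 \<alpha>(3) by simp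
    qed
    then have half: "\<alpha> < s / 2" "s / 2 \<le> pi / 2" using assms(5) by auto
    then have "cos (s / 2) \<le> cos \<alpha>" "0 \<le> cos (s / 2)"
      using \<alpha> by (auto intro!: cos_monotone_0_pi_le cos_ge_zero)
    then have a0: "0 \<le> a" and "(cos (s / 2))\<^sup>2 \<le> a\<^sup>2" using \<alpha>(3) by (auto intro!: power_mono)
    then have "4 * (1 - a\<^sup>2) \<le> 2 * (1 - cos s)" using cos_double_cos[of "s / 2"] by simp
    moreover have "(b - a)\<^sup>2 \<le> (1 - a)\<^sup>2" using assms(2,3) by (intro power_mono) auto
    moreover have "0 \<le> (1 - a) * (3 + 5 * a)" using a0 assms(2,3) by simp
    then have "(1 - a)\<^sup>2 \<le> 4 * (1 - a\<^sup>2)" by (simp add: power2_eq_square algebra_simps)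
    ultimately show ?thesis by linarith
  qed
qed

lemma leave_interval_from_right_end:
  assumes "-1 \<le> a" "a < b" "b \<le> 1" "0 \<le> s" "s \<le> pi"
    and out: "\<not> (a \<le> cos (arccos b + s) \<and> cos (arccos b + s) \<le> b)"
  shows "(b - a)\<^sup>2 \<le> 2 * (1 - cos s)"
proof -
  have "arccos (- b) - s = pi - (arccos b + s)" using assms by (simp add: arccos_minus)
  then have "cos (arccos (- b) - s) = - cos (arccos b + s)" by (simp only: cos_pi_minus)
  then show ?thesis
    using leave_interval_from_left_end[of "- b" "- a" s] assms by auto
qed

section \<open>Errors outside, inside and at the ends of the interval\<close>

locale cutoff_poly =
  fixes a b B :: real and p :: "real poly" and n d :: nat
  assumes a_ge: "-1 \<le> a" and a_less_b: "a < b" and b_le: "b \<le> 1"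
    and n_ge: "1 \<le> n" and deg: "degree p \<le> n" and d_ge: "2 \<le> d"
    and bnd: "\<And>y. a \<le> y \<Longrightarrow> y \<le> b \<Longrightarrow> \<bar>poly p y\<bar> \<le> B"
begin

lemma B_nonneg: "0 \<le> B"
  using bnd[of a] a_less_b by simp

lemma bnd_Icc: "y \<in> {a..b} \<Longrightarrow> \<bar>poly p y\<bar> \<le> B"
  using bnd by simp

lemma abs_cutoff_le: "\<bar>cutoff a b p y\<bar> \<le> B"
  using bnd B_nonneg by (simp add: cutoff_def)

lemma abs_cutoff_le_tail:
  assumes "0 < \<Delta>" "s \<le> pi" "s < \<Delta> \<Longrightarrow> cutoff a b p y = 0"
  shows "\<bar>cutoff a b p y\<bar> \<le> B * (pi ^ 4 / (4 * \<Delta> ^ 4) * (1 - cos s)\<^sup>2)"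
proof (cases "s < \<Delta>")
  case False
  have "\<bar>cutoff a b p y\<bar> \<le> B * 1" using abs_cutoff_le by simp
  also have "\<dots> \<le> B * (pi ^ 4 / (4 * \<Delta> ^ 4) * (1 - cos s)\<^sup>2)"
    using False assms B_nonneg by (intro mult_left_mono one_le_tail_weight) auto
  finally show ?thesis .
qed (use assms B_nonneg in auto)

text \<open>An error of size B beyond distance \<Delta> costs half of \<gamma>. The full \<gamma> is
  consumed at inner points, where the error can reach 2B.\<close>

lemma tail_sum_eq:
  "B * (pi ^ 4 / (4 * \<Delta> ^ 4)) * (2 * pi\<^sup>2 / real (d + 2) ^ 3)
     = pi ^ 6 * B / (\<Delta> ^ 4 * real (d + 2) ^ 3) / 2"
proof -
  have "pi ^ 4 * pi\<^sup>2 = pi ^ 6" by (simp flip: power_add)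
  moreover have "B * (X / (4 * Y)) * (2 * Z / W) = (X * Z) * B / (Y * W) / 2" for X Y Z W :: real
    by (simp add: mult_ac)
  ultimately show ?thesis by (simp only:)
qed

lemma gamma_nonneg: "0 \<le> pi ^ 6 * B / (\<Delta> ^ 4 * real (d + 2) ^ 3)"
  using B_nonneg by simp

lemma CJ_outside:
  assumes x: "-1 \<le> x" "x \<le> 1" and \<Delta>: "0 < \<Delta>"
    and far: "x < a \<and> \<Delta> \<le> arccos x - arccos a \<or> b < x \<and> \<Delta> \<le> arccos b - arccos x"
  shows "\<bar>poly (CJ_series a b d p) x\<bar> \<le> pi ^ 6 * B / (\<Delta> ^ 4 * real (d + 2) ^ 3)"
proof -
  define \<theta> where "\<theta> = arccos x"
  have \<theta>: "0 \<le> \<theta>" "\<theta> \<le> pi" "cos \<theta> = x"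
    using x by (auto simp: \<theta>_def arccos_lbound arccos_ubound)
  define c where "c = B * (pi ^ 4 / (4 * \<Delta> ^ 4))"
  have ca: "cos (arccos a) = a" "cos (arccos b) = b" "0 \<le> arccos a" "arccos b \<le> pi"
    using a_ge a_less_b b_le by (auto simp: arccos_lbound arccos_ubound)
  have zero: "cutoff a b p (cos (\<theta> + t)) = 0" if t: "\<bar>t\<bar> < \<Delta>" for t
    using far
  proof (elim disjE conjE)
    \<comment> \<open>The shifted angle may exceed pi, but t < \<Delta> <= pi - arccos a keeps it
      below 2pi - arccos a. In the other case it may become negative, which the absolute value in
      \<open>cos_less_inside\<close> absorbs.\<close>
    assume "x < a" "\<Delta> \<le> arccos x - arccos a"
    then have "cos (\<theta> + t) < cos (arccos a)"
      using t ca \<theta> by (intro cos_less_outside) (auto simp: \<theta>_def)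
    then show ?thesis using ca by (simp add: cutoff_def)
  next
    assume "b < x" "\<Delta> \<le> arccos b - arccos x"
    then have "cos (arccos b) < cos (\<theta> + t)"
      using t ca \<theta> by (intro cos_less_inside) (auto simp: \<theta>_def)
    then show ?thesis using ca by (simp add: cutoff_def)
  qed
  have "\<bar>poly (CJ_series a b d p) (cos \<theta>) - 0\<bar>
      \<le> 0 + 0 * (pi\<^sup>2 / (2 * (real (d + 2))\<^sup>2)) + c * (2 * pi\<^sup>2 / real (d + 2) ^ 3)"
  proof (rule CJ_series_error[OF a_ge a_less_b b_le \<theta>(1,2) d_ge])
    fix s :: real assume s: "0 < s" "s < pi"
    have "\<bar>cutoff a b p (cos (\<theta> + s))\<bar> \<le> c * (1 - cos s)\<^sup>2"
      unfolding c_def mult.assoc by (rule abs_cutoff_le_tail[OF \<Delta>]) (use s zero[of s] in auto)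
    moreover have "\<bar>cutoff a b p (cos (\<theta> - s))\<bar> \<le> c * (1 - cos s)\<^sup>2"
      unfolding c_def mult.assoc by (rule abs_cutoff_le_tail[OF \<Delta>]) (use s zero[of "- s"] in auto)
    ultimately show "\<bar>cutoff_mean a b p \<theta> s - 0\<bar> \<le> 0 + 0 * (1 - cos s) + c * (1 - cos s)\<^sup>2"
      unfolding cutoff_mean_def by simp
  qed (use B_nonneg \<Delta> in \<open>auto simp: c_def\<close>)
  then show ?thesis using tail_sum_eq[of \<Delta>] gamma_nonneg[of \<Delta>] by (simp add: \<theta> c_def)
qed

text \<open>For s < \<Delta> both shifts stay in the interval and the second difference is
  controlled by c1, which times the first moment is the \<delta> term. For larger s the crude bound
  2B is charged to the second moment, giving the \<gamma> term.\<close>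

lemma CJ_inside:
  assumes x: "a < x" "x < b" and \<Delta>: "0 < \<Delta>"
    and far: "\<Delta> \<le> arccos a - arccos x" "\<Delta> \<le> arccos x - arccos b"
  shows "\<bar>poly (CJ_series a b d p) x - poly p x\<bar>
    \<le> pi ^ 6 * B / (\<Delta> ^ 4 * real (d + 2) ^ 3)
      + (pi\<^sup>2 * (real n)\<^sup>2 / ((b - a) * real (d + 2)))\<^sup>2 * (B / 2)"
proof -
  define \<theta> where "\<theta> = arccos x"
  have \<theta>: "0 \<le> \<theta>" "\<theta> \<le> pi" "cos \<theta> = x"
    using x a_ge b_le by (auto simp: \<theta>_def arccos_lbound arccos_ubound)
  have ca: "cos (arccos a) = a" "cos (arccos b) = b" "0 \<le> arccos b" "arccos a \<le> pi"
    using a_ge a_less_b b_le by (auto simp: arccos_lbound arccos_ubound)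
  define c where "c = B * (pi ^ 4 / (4 * \<Delta> ^ 4))"
  define c1 where "c1 = pi\<^sup>2 * real n ^ 4 * B / (b - a)\<^sup>2"
  have c: "0 \<le> c" "0 \<le> c1" using B_nonneg \<Delta> by (auto simp: c_def c1_def)
  have mem: "a \<le> cos (\<theta> + t) \<and> cos (\<theta> + t) \<le> b" if t: "\<bar>t\<bar> < \<Delta>" for t
  proof -
    have "arccos b \<le> \<theta> + t" "\<theta> + t \<le> arccos a" using t far by (auto simp: \<theta>_def)
    then have "cos (arccos a) \<le> cos (\<theta> + t)" "cos (\<theta> + t) \<le> cos (arccos b)"
      using cos_monotone_0_pi_le[of "\<theta> + t" "arccos a"] cos_monotone_0_pi_le[of "arccos b" "\<theta> + t"]
        ca(3,4) by linarith+
    then show ?thesis using ca by simp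
  qed
  have "\<bar>poly (CJ_series a b d p) (cos \<theta>) - poly p x\<bar>
      \<le> 0 + c1 * (pi\<^sup>2 / (2 * (real (d + 2))\<^sup>2)) + (2 * c) * (2 * pi\<^sup>2 / real (d + 2) ^ 3)"
  proof (rule CJ_series_error[OF a_ge a_less_b b_le \<theta>(1,2) d_ge])
    fix s :: real assume s: "0 < s" "s < pi"
    have u: "0 \<le> 1 - cos s" by simp
    show "\<bar>cutoff_mean a b p \<theta> s - poly p x\<bar> \<le> 0 + c1 * (1 - cos s) + 2 * c * (1 - cos s)\<^sup>2"
    proof (cases "s < \<Delta>")
      case True
      have m: "a \<le> cos (\<theta> + s) \<and> cos (\<theta> + s) \<le> b" "a \<le> cos (\<theta> - s) \<and> cos (\<theta> - s) \<le> b"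
        using mem[of s] mem[of "- s"] True s by auto
      have "\<bar>(poly p (cos (\<theta> + s)) + poly p (cos (\<theta> - s))) / 2 - poly p (cos \<theta>)\<bar>
          \<le> c1 * (1 - cos s)"
        unfolding c1_def
      proof (rule poly_cos_second_difference[OF a_less_b _ n_ge deg bnd_Icc])
        show "b - a \<le> 2" using a_ge b_le by simp
      qed (use m x \<theta>(3) in simp_all)
      then have "\<bar>cutoff_mean a b p \<theta> s - poly p x\<bar> \<le> c1 * (1 - cos s)"
        using m by (simp add: cutoff_mean_def cutoff_def \<theta>(3))
      also have "\<dots> \<le> 0 + c1 * (1 - cos s) + 2 * c * (1 - cos s)\<^sup>2" using c by simp
      finally show ?thesis .
    next
      case False
      have "\<bar>cutoff_mean a b p \<theta> s - poly p x\<bar> \<le> 2 * B"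
        using abs_cutoff_le[of "cos (\<theta> + s)"] abs_cutoff_le[of "cos (\<theta> - s)"] bnd[of x] x
        unfolding cutoff_mean_def add_divide_distrib by linarith
      also have "\<dots> = 2 * B * 1" by simp
      also have "\<dots> \<le> 2 * B * (pi ^ 4 / (4 * \<Delta> ^ 4) * (1 - cos s)\<^sup>2)"
        using False \<Delta> s B_nonneg by (intro mult_left_mono one_le_tail_weight) auto
      also have "\<dots> = 2 * c * (1 - cos s)\<^sup>2" by (simp add: c_def)
      also have "\<dots> \<le> 0 + c1 * (1 - cos s) + 2 * c * (1 - cos s)\<^sup>2" using c by simp
      finally show ?thesis .
    qed
  qed (use c in auto)
  moreover have "2 * c * (2 * pi\<^sup>2 / real (d + 2) ^ 3) = pi ^ 6 * B / (\<Delta> ^ 4 * real (d + 2) ^ 3)"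
    using tail_sum_eq[of \<Delta>] by (simp add: c_def)
  moreover have "c1 * (pi\<^sup>2 / (2 * (real (d + 2))\<^sup>2))
      = (pi\<^sup>2 * (real n)\<^sup>2 / ((b - a) * real (d + 2)))\<^sup>2 * (B / 2)"
    by (simp add: c1_def power_divide power_mult_distrib)
      (simp add: power2_eq_square power4_eq_xxxx mult_ac)
  ultimately show ?thesis by (simp only: \<theta>)
qed

definition lip :: real where "lip = 3 * (real n)\<^sup>2 * B / (b - a)"

lemma lip_nonneg: "0 \<le> lip"
  using B_nonneg a_less_b by (simp add: lip_def)

text \<open>Once the cut-off has dropped to 0 the error is at most B, and B <= lip (b - a). So a
  departure from the interval still obeys the Lipschitz bound, provided that it happens only at r >=
  b - a.\<close>

lemma cutoff_near_end:
  assumes e: "e = a \<or> e = b" and near: "\<bar>y - e\<bar> \<le> r"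
    and out: "\<not> (a \<le> y \<and> y \<le> b) \<Longrightarrow> b - a \<le> r"
  shows "\<bar>cutoff a b p y - poly p e\<bar> \<le> lip * r"
proof (cases "a \<le> y \<and> y \<le> b")
  case True
  then have "\<bar>cutoff a b p y - poly p e\<bar> \<le> lip * \<bar>y - e\<bar>"
    using poly_lipschitz_at_end[OF a_less_b n_ge deg bnd_Icc e, of y] by (simp add: cutoff_def lip_def)
  also have "\<dots> \<le> lip * r" using near lip_nonneg by (intro mult_left_mono)
  finally show ?thesis .
next
  case False
  have "1 * B \<le> (3 * (real n)\<^sup>2) * B"
  proof (rule mult_right_mono[OF _ B_nonneg])
    have "1 \<le> (real n)\<^sup>2" using n_ge by (intro one_le_power) simp
    then show "1 \<le> 3 * (real n)\<^sup>2" by linarith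
  qed
  also have "\<dots> = lip * (b - a)" using a_less_b by (simp add: lip_def)
  also have "\<dots> \<le> lip * r" using out[OF False] lip_nonneg by (intro mult_left_mono)
  finally have "B \<le> lip * r" by simp
  moreover have "\<bar>poly p e\<bar> \<le> B" using e a_less_b by (intro bnd) auto
  ultimately show ?thesis using False by (auto simp: cutoff_def)
qed

text \<open>One of the two shifts of \<open>\<theta>\<close> by \<open>\<plusminus>s\<close> enters the interval, the other one leaves it; only half
  of the mass of the kernel sees the polynomial.\<close>

lemma CJ_end:
  assumes e: "e = a \<or> e = b" and \<theta>: "0 \<le> \<theta>" "\<theta> \<le> pi" "cos \<theta> = e" and \<Delta>: "0 < \<Delta>"
    and sgn: "\<sigma> = 1 \<or> \<sigma> = -1"
    and enters: "\<And>s. 0 < s \<Longrightarrow> s < pi \<Longrightarrow> \<not> (a \<le> cos (\<theta> - \<sigma> * s) \<and> cos (\<theta> - \<sigma> * s) \<le> b) \<Longrightarrow>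
      (b - a)\<^sup>2 \<le> 2 * (1 - cos s)"
    and leaves: "\<And>s. 0 < s \<Longrightarrow> s < \<Delta> \<Longrightarrow> cutoff a b p (cos (\<theta> + \<sigma> * s)) = 0"
  shows "\<bar>poly (CJ_series a b d p) e - poly p e / 2\<bar>
    \<le> pi ^ 6 * B / (\<Delta> ^ 4 * real (d + 2) ^ 3)
      + pi\<^sup>2 * (real n)\<^sup>2 / ((b - a) * real (d + 2)) * (B / 2)"
proof -
  \<comment> \<open>The width of the kernel. Splitting sqrt(2u) by the arithmetic-geometric mean at
    this scale makes the constant and the first-moment term contribute lip r/4 each.\<close>
  define r where "r = pi / real (d + 2)"
  have r: "0 < r" by (simp add: r_def)
  have half_bound: "\<bar>(x + y) / 2 - v / 2\<bar> \<le> s / 2 + t / 2 + z / 2"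
    if "\<bar>x\<bar> \<le> z" "\<bar>y - v\<bar> \<le> s + t" for x y v s t z :: real
    using that unfolding add_divide_distrib by linarith
  have sum_bound: "x \<le> g + h"
    if "x \<le> s + t + y" "y \<le> g" "s + t = z" "z \<le> h" for x g h s t y z :: real
    using that by linarith
  define c where "c = B * (pi ^ 4 / (4 * \<Delta> ^ 4))"
  have c: "0 \<le> c" using B_nonneg \<Delta> by (simp add: c_def)
  have "\<bar>poly (CJ_series a b d p) (cos \<theta>) - poly p e / 2\<bar>
      \<le> lip * r / 4 + lip / (2 * r) * (pi\<^sup>2 / (2 * (real (d + 2))\<^sup>2)) + c * (2 * pi\<^sup>2 / real (d + 2) ^ 3)"
  proof (rule CJ_series_error[OF a_ge a_less_b b_le \<theta>(1,2) d_ge])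
    fix s :: real assume s: "0 < s" "s < pi"
    define u where "u = 1 - cos s"
    have u: "0 \<le> u" by (simp add: u_def)
    have cs: "cos (\<sigma> * s) = cos s" using sgn by auto
    have "(cos (\<theta> - \<sigma> * s) - e)\<^sup>2 \<le> (sqrt (2 * u))\<^sup>2"
      using cos_chord_le[of \<theta> "- (\<sigma> * s)"] u cs \<theta>(3) by (simp add: u_def)
    then have near: "\<bar>cos (\<theta> - \<sigma> * s) - e\<bar> \<le> sqrt (2 * u)"
      using u by (simp add: real_le_rsqrt abs_le_square_iff flip: real_sqrt_abs)
    \<comment> \<open>Here \<open>enters\<close> says that b - a <= sqrt(2u) whenever the interval
      is left, as \<open>cutoff_near_end\<close> demands of the radius.\<close>
    have "\<bar>cutoff a b p (cos (\<theta> - \<sigma> * s)) - poly p e\<bar> \<le> lip * sqrt (2 * u)"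
      using enters[OF s] by (intro cutoff_near_end[OF e near] real_le_rsqrt) (simp add: u_def)
    also have "\<dots> \<le> lip * ((r + 2 * u / r) / 2)"
    proof (rule mult_left_mono[OF _ lip_nonneg])
      have "sqrt (r * (2 * u / r)) \<le> (r + 2 * u / r) / 2"
        using r u by (intro arith_geo_mean_sqrt) auto
      then show "sqrt (2 * u) \<le> (r + 2 * u / r) / 2" using r by simp
    qed
    finally have 1: "\<bar>cutoff a b p (cos (\<theta> - \<sigma> * s)) - poly p e\<bar> \<le> lip * r / 2 + lip / r * u"
      by (simp add: algebra_simps add_divide_distrib)
    have 2: "\<bar>cutoff a b p (cos (\<theta> + \<sigma> * s))\<bar> \<le> c * u\<^sup>2"
      unfolding c_def mult.assoc u_def by (rule abs_cutoff_le_tail[OF \<Delta>]) (use s leaves in auto)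
    have eq: "cutoff_mean a b p \<theta> s
        = (cutoff a b p (cos (\<theta> + \<sigma> * s)) + cutoff a b p (cos (\<theta> - \<sigma> * s))) / 2"
      using sgn by (auto simp: cutoff_mean_def)
    have "\<bar>cutoff_mean a b p \<theta> s - poly p e / 2\<bar> \<le> lip * r / 4 + (lip / r * u) / 2 + c * u\<^sup>2 / 2"
      unfolding eq using half_bound[OF 2 1] by simp
    also have "(lip / r * u) / 2 = lip / (2 * r) * u" by simp
    also have "lip * r / 4 + lip / (2 * r) * u + c * u\<^sup>2 / 2 \<le> lip * r / 4 + lip / (2 * r) * u + c * u\<^sup>2"
      using c by simp
    finally show "\<bar>cutoff_mean a b p \<theta> s - poly p e / 2\<bar>
        \<le> lip * r / 4 + lip / (2 * r) * (1 - cos s) + c * (1 - cos s)\<^sup>2"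
      by (simp add: u_def)
  qed (use c lip_nonneg r in auto)
  moreover have "c * (2 * pi\<^sup>2 / real (d + 2) ^ 3) \<le> pi ^ 6 * B / (\<Delta> ^ 4 * real (d + 2) ^ 3)"
    using tail_sum_eq[of \<Delta>] gamma_nonneg[of \<Delta>] by (simp add: c_def)
  moreover have "lip * r / 4 + lip / (2 * r) * (pi\<^sup>2 / (2 * (real (d + 2))\<^sup>2)) = lip * r / 2"
  proof -
    have sq: "pi\<^sup>2 / (2 * (real (d + 2))\<^sup>2) = r * r / 2" by (simp add: r_def power2_eq_square)
    show ?thesis unfolding sq using r by simp
  qed
  moreover have "lip * r / 2 \<le> pi\<^sup>2 * (real n)\<^sup>2 / ((b - a) * real (d + 2)) * (B / 2)"
  proof -
    define Q where "Q = (real n)\<^sup>2 * B * pi / ((b - a) * real (d + 2))"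
    have "0 \<le> Q" using B_nonneg a_less_b by (simp add: Q_def)
    then have "3 * Q \<le> pi * Q" using pi_gt3 by (intro mult_right_mono) auto
    moreover have "lip * r = 3 * Q" by (simp add: lip_def r_def Q_def mult_ac)
    moreover have "pi\<^sup>2 * (real n)\<^sup>2 / ((b - a) * real (d + 2)) * (B / 2) = pi * Q / 2"
      by (simp add: Q_def power2_eq_square)
    ultimately show ?thesis by simp
  qed
  ultimately show ?thesis
    unfolding \<theta>(3) by (rule sum_bound)
qed

lemma CJ_left_end:
  assumes "0 < \<Delta>" "\<Delta> \<le> pi - arccos a"
  shows "\<bar>poly (CJ_series a b d p) a - poly p a / 2\<bar>
    \<le> pi ^ 6 * B / (\<Delta> ^ 4 * real (d + 2) ^ 3)
      + pi\<^sup>2 * (real n)\<^sup>2 / ((b - a) * real (d + 2)) * (B / 2)"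
proof (rule CJ_end[where \<theta> = "arccos a" and \<sigma> = 1])
  have a: "cos (arccos a) = a" "0 \<le> arccos a"
    using a_ge a_less_b b_le by (auto simp: arccos_lbound)
  fix s :: real
  show "cutoff a b p (cos (arccos a + 1 * s)) = 0" if "0 < s" "s < \<Delta>"
    using cos_less_outside[of "arccos a" "arccos a + s"] that assms a by (simp add: cutoff_def)
  show "(b - a)\<^sup>2 \<le> 2 * (1 - cos s)"
    if "0 < s" "s < pi" "\<not> (a \<le> cos (arccos a - 1 * s) \<and> cos (arccos a - 1 * s) \<le> b)"
    using leave_interval_from_left_end[of a b s] that a_ge a_less_b b_le by simp
qed (use assms a_ge a_less_b b_le in \<open>auto simp: arccos_lbound arccos_ubound\<close>)

lemma CJ_right_end:
  assumes "0 < \<Delta>" "\<Delta> \<le> arccos b"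
  shows "\<bar>poly (CJ_series a b d p) b - poly p b / 2\<bar>
    \<le> pi ^ 6 * B / (\<Delta> ^ 4 * real (d + 2) ^ 3)
      + pi\<^sup>2 * (real n)\<^sup>2 / ((b - a) * real (d + 2)) * (B / 2)"
proof (rule CJ_end[where \<theta> = "arccos b" and \<sigma> = "-1"])
  have b: "cos (arccos b) = b" "arccos b \<le> pi"
    using a_ge a_less_b b_le by (auto simp: arccos_ubound)
  fix s :: real
  show "cutoff a b p (cos (arccos b + -1 * s)) = 0" if "0 < s" "s < \<Delta>"
    using cos_less_inside[of "arccos b" "arccos b - s"] that assms b by (simp add: cutoff_def)
  show "(b - a)\<^sup>2 \<le> 2 * (1 - cos s)"
    if "0 < s" "s < pi" "\<not> (a \<le> cos (arccos b - -1 * s) \<and> cos (arccos b - -1 * s) \<le> b)"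
    using leave_interval_from_right_end[of a b s] that a_ge a_less_b b_le by simp
qed (use assms a_ge a_less_b b_le in \<open>auto simp: arccos_lbound arccos_ubound\<close>)

text \<open>At \<open>\<plusminus>1\<close> both shifts enter the interval, so the polynomial is reproduced in full.\<close>

lemma CJ_pole:
  assumes e: "e = a \<and> a = -1 \<or> e = b \<and> b = 1"
  shows "\<bar>poly (CJ_series a b d p) e - poly p e\<bar>
    \<le> (pi\<^sup>2 * (real n)\<^sup>2 / ((b - a) * real (d + 2)))\<^sup>2 * (B / 2)"
proof -
  define \<theta> where "\<theta> = arccos e"
  have \<theta>: "0 \<le> \<theta>" "\<theta> \<le> pi" "cos \<theta> = e" "e = 1 \<or> e = -1" "e = a \<or> e = b"
    using e by (auto simp: \<theta>_def)
  \<comment> \<open>The two shifts coincide, and their distance from e is exactly 1 - cos s; a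
    Lipschitz bound therefore already gives second order in 1/(d+2).\<close>
  have sh: "cos (\<theta> + s) = e * cos s" "cos (\<theta> - s) = e * cos s" for s
    using \<theta>(4) by (auto simp: \<theta>_def cos_add cos_diff)
  have "\<bar>poly (CJ_series a b d p) (cos \<theta>) - poly p e\<bar>
      \<le> 0 + lip * (pi\<^sup>2 / (2 * (real (d + 2))\<^sup>2)) + 0 * (2 * pi\<^sup>2 / real (d + 2) ^ 3)"
  proof (rule CJ_series_error[OF a_ge a_less_b b_le \<theta>(1,2) d_ge lip_nonneg order_refl])
    fix s :: real
    have "\<bar>cutoff a b p (e * cos s) - poly p e\<bar> \<le> lip * (1 - cos s)"
    proof (rule cutoff_near_end[OF \<theta>(5)])
      show "\<bar>e * cos s - e\<bar> \<le> 1 - cos s" using \<theta>(4) by auto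
      show "b - a \<le> 1 - cos s" if "\<not> (a \<le> e * cos s \<and> e * cos s \<le> b)"
        using that e cos_le_one[of s] cos_ge_minus_one[of s] by (auto simp del: cos_le_one cos_ge_minus_one)
    qed
    then show "\<bar>cutoff_mean a b p \<theta> s - poly p e\<bar> \<le> 0 + lip * (1 - cos s) + 0 * (1 - cos s)\<^sup>2"
      by (simp add: cutoff_mean_def sh)
  qed
  also have "0 + lip * (pi\<^sup>2 / (2 * (real (d + 2))\<^sup>2)) + 0 * (2 * pi\<^sup>2 / real (d + 2) ^ 3)
      \<le> (pi\<^sup>2 * (real n)\<^sup>2 / ((b - a) * real (d + 2)))\<^sup>2 * (B / 2)"
  proof -
    \<comment> \<open>Q is the common factor of both sides; what remains is 3w <= 6 <= 9 <= pi^2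
      n^2.\<close>
    define Q w m where "Q = B * pi\<^sup>2 * (real n)\<^sup>2 / (2 * (b - a)\<^sup>2 * (real (d + 2))\<^sup>2)"
      and "w = b - a" and "m = (real n)\<^sup>2"
    have w: "0 < w" "w \<le> 2" using a_ge a_less_b b_le by (auto simp: w_def)
    have "1 \<le> m" using n_ge unfolding m_def by (intro one_le_power) simp
    moreover have "9 \<le> pi\<^sup>2" using pi_gt3 power_mono[of 3 pi 2] by simp
    ultimately have "9 * 1 \<le> pi\<^sup>2 * m" by (intro mult_mono) auto
    moreover have "0 \<le> Q" using B_nonneg by (simp add: Q_def)
    ultimately have "3 * w * Q \<le> pi\<^sup>2 * m * Q" using w by (intro mult_right_mono) auto
    moreover have "lip * (pi\<^sup>2 / (2 * (real (d + 2))\<^sup>2)) = 3 * w * Q"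
    proof -
      have "3 * m * B / w * (X / (2 * Y)) = 3 * w * (B * X * m / (2 * w\<^sup>2 * Y))" for X Y
        using w by (simp add: power2_eq_square mult_ac)
      then show ?thesis by (simp only: lip_def Q_def w_def m_def)
    qed
    moreover have "(pi\<^sup>2 * (real n)\<^sup>2 / ((b - a) * real (d + 2)))\<^sup>2 * (B / 2) = pi\<^sup>2 * m * Q"
    proof -
      have "(X * k / (v * Y))\<^sup>2 * (B / 2) = X * k * (B * X * k / (2 * v\<^sup>2 * Y\<^sup>2))" for X Y k v :: real
        by (simp add: power2_eq_square mult_ac)
      then show ?thesis by (simp only: Q_def m_def)
    qed
    ultimately show ?thesis by simp
  qed
  finally show ?thesis by (simp only: \<theta>(3))
qed

end

section \<open>Existence of best approximations\<close>

text \<open>Induction on the number of free coordinates replaces compactness in several dimensions.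
  Minimising over the first m coordinates, for every x, gives the quotient seminorm D; only a
  Lipschitz function g of the next coordinate is left to minimise. A seminorm suffices, so dependent
  directions cause no trouble.\<close>

lemma seminorm_best_approx:
  fixes q :: "(nat \<Rightarrow> real) \<Rightarrow> real"
  assumes tri: "\<And>x y. q (\<lambda>k. x k + y k) \<le> q x + q y"
    and hom: "\<And>r x. q (\<lambda>k. r * x k) = \<bar>r\<bar> * q x"
  shows "\<exists>y. (\<forall>k\<ge>m. y k = 0) \<and>
    (\<forall>z. (\<forall>k\<ge>m. z k = 0) \<longrightarrow> q (\<lambda>k. x k + y k) \<le> q (\<lambda>k. x k + z k))"
proof (induction m arbitrary: x)
  case 0
  then show ?case by (auto intro!: exI[of _ "\<lambda>_. 0"])
next
  case (Suc m)
  define P where "P y \<longleftrightarrow> (\<forall>k\<ge>m. y k = 0)" for y :: "nat \<Rightarrow> real"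
  obtain Y where Y: "\<And>x. P (Y x)" "\<And>x z. P z \<Longrightarrow> q (\<lambda>k. x k + Y x k) \<le> q (\<lambda>k. x k + z k)"
    using Suc unfolding P_def by metis
  define D where "D x = q (\<lambda>k. x k + Y x k)" for x
  have D_le: "D x \<le> q (\<lambda>k. x k + z k)" if "P z" for x z
    using Y(2)[OF that] by (simp add: D_def)
  have nn: "0 \<le> q x" for x
    using tri[of x "\<lambda>k. (-1) * x k"] hom[of "-1" x] hom[of 0 x] by simp
  have D_tri: "D (\<lambda>k. x k + y k) \<le> D x + D y" for x y
  proof -
    have "D (\<lambda>k. x k + y k) \<le> q (\<lambda>k. (x k + y k) + (Y x k + Y y k))"
      using Y(1)[of x] Y(1)[of y] by (intro D_le) (auto simp: P_def)
    also have "\<dots> = q (\<lambda>k. (x k + Y x k) + (y k + Y y k))" by (simp add: ac_simps)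
    also have "\<dots> \<le> D x + D y" unfolding D_def by (rule tri)
    finally show ?thesis .
  qed
  have D_hom_le: "D (\<lambda>k. r * x k) \<le> \<bar>r\<bar> * D x" for r x
  proof -
    have "D (\<lambda>k. r * x k) \<le> q (\<lambda>k. r * x k + r * Y x k)"
      using Y(1)[of x] by (intro D_le) (auto simp: P_def)
    also have "\<dots> = q (\<lambda>k. r * (x k + Y x k))" by (simp add: distrib_left)
    finally show ?thesis by (simp add: hom D_def)
  qed
  define e where "e k = (if k = m then 1 else 0 :: real)" for k :: nat
  define g where "g c = D (\<lambda>k. x k + c * e k)" for c
  have De: "0 \<le> D e" by (simp add: D_def nn)
  have lip: "g c \<le> g c' + \<bar>c - c'\<bar> * D e" for c c'
  proof -
    have "g c = D (\<lambda>k. (x k + c' * e k) + (c - c') * e k)"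
      by (simp add: g_def algebra_simps)
    also have "\<dots> \<le> g c' + D (\<lambda>k. (c - c') * e k)" unfolding g_def by (rule D_tri)
    finally show ?thesis using D_hom_le[of "c - c'" e] by linarith
  qed
  have "\<exists>c. \<forall>c'. g c \<le> g c'"
  proof (cases "D e = 0")
    case True
    \<comment> \<open>A direction of zero seminorm: g is constant.\<close>
    then show ?thesis using lip[of 0] by auto
  next
    case False
    then have pos: "0 < D e" using De by simp
    \<comment> \<open>Outside this radius g c' >= |c'| D e - D x > D x = g 0, so the minimum over
      the compact interval is global.\<close>
    define R where "R = 2 * D x / D e"
    have R: "0 \<le> R" using pos by (simp add: R_def D_def nn)
    have "continuous_on {-R..R} g"
      unfolding continuous_on_iff dist_real_def
    proof (intro ballI allI impI)
      fix c \<epsilon> :: real assume "c \<in> {-R..R}" "0 < \<epsilon>"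
      have "\<bar>g c' - g c\<bar> < \<epsilon>" if "\<bar>c' - c\<bar> < \<epsilon> / D e" for c'
      proof -
        have "\<bar>c' - c\<bar> * D e < \<epsilon>" using that pos by (simp add: pos_less_divide_eq)
        then show ?thesis using lip[of c c'] lip[of c' c] by (simp add: abs_minus_commute)
      qed
      then show "\<exists>d>0. \<forall>c'\<in>{-R..R}. \<bar>c' - c\<bar> < d \<longrightarrow> \<bar>g c' - g c\<bar> < \<epsilon>"
        using \<open>0 < \<epsilon>\<close> pos by (intro exI[of _ "\<epsilon> / D e"]) auto
    qed
    then obtain c where c: "c \<in> {-R..R}" "\<And>c'. c' \<in> {-R..R} \<Longrightarrow> g c \<le> g c'"
      using continuous_attains_inf[of "{-R..R}" g] R by (metis atLeastAtMost_iff compact_Icc empty_iff neg_le_iff_le order.trans neg_le_0_iff_le)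
    have "g c \<le> g c'" for c'
    proof (cases "c' \<in> {-R..R}")
      case False
      then have "R < \<bar>c'\<bar>" by auto
      then have "2 * D x < \<bar>c'\<bar> * D e" using pos by (simp add: R_def pos_divide_less_eq)
      also have "\<bar>c'\<bar> * D e \<le> D (\<lambda>k. c' * e k)"
      proof -
        have "c' \<noteq> 0" using \<open>R < \<bar>c'\<bar>\<close> R by auto
        then have "D e = D (\<lambda>k. 1 / c' * (c' * e k))" by simp
        also have "\<dots> \<le> \<bar>1 / c'\<bar> * D (\<lambda>k. c' * e k)" by (rule D_hom_le)
        finally show ?thesis using \<open>c' \<noteq> 0\<close> by (simp add: field_simps)
      qed
      also have "D (\<lambda>k. c' * e k) = D (\<lambda>k. (x k + c' * e k) + (-1) * x k)" by simp
      also have "\<dots> \<le> g c' + D (\<lambda>k. (-1) * x k)" unfolding g_def by (rule D_tri)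
      finally have "D x < g c'" using D_hom_le[of "-1" x] by simp
      moreover have "g c \<le> g 0" using c(2) R by simp
      ultimately show ?thesis by (simp add: g_def)
    qed (use c in auto)
    then show ?thesis by blast
  qed
  then obtain c where c: "\<And>c'. g c \<le> g c'" by blast
  define y where "y k = c * e k + Y (\<lambda>k. x k + c * e k) k" for k
  have "\<forall>k\<ge>Suc m. y k = 0"
    using Y(1)[of "\<lambda>k. x k + c * e k"] by (auto simp: y_def e_def P_def)
  moreover have "q (\<lambda>k. x k + y k) \<le> q (\<lambda>k. x k + z k)" if z: "\<forall>k\<ge>Suc m. z k = 0" for z
  proof -
    have "q (\<lambda>k. x k + y k) = g c" by (simp add: y_def g_def D_def add.assoc)
    also have "\<dots> \<le> g (z m)" by (rule c)
    also have "\<dots> \<le> q (\<lambda>k. (x k + z m * e k) + (z k - z m * e k))"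
      unfolding g_def
    proof (rule D_le, unfold P_def, intro allI impI)
      fix k assume "m \<le> k"
      then show "z k - z m * e k = 0" using z by (cases "k = m") (auto simp: e_def)
    qed
    finally show ?thesis by simp
  qed
  ultimately show ?case by blast
qed

text \<open>The affine problem is made linear by letting coordinate m multiply w; the base point
  \<open>e\<close> fixes that coordinate to 1.\<close>

lemma max_norm_best_approx:
  fixes v :: "nat \<Rightarrow> 'j \<Rightarrow> real"
  assumes J: "finite J"
  defines "N \<equiv> \<lambda>f :: 'j \<Rightarrow> real. Max (insert 0 ((\<lambda>j. \<bar>f j\<bar>) ` J))"
  shows "\<exists>c. \<forall>c'. N (\<lambda>j. w j + (\<Sum>k<m. c k * v k j)) \<le> N (\<lambda>j. w j + (\<Sum>k<m. c' k * v k j))"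
proof -
  have N_le: "N f \<le> r" if "0 \<le> r" "\<And>j. j \<in> J \<Longrightarrow> \<bar>f j\<bar> \<le> r" for f r
    unfolding N_def using J that by auto
  have N_ge: "\<bar>f j\<bar> \<le> N f" if "j \<in> J" for f j
    unfolding N_def using J that by (intro Max_ge) auto
  have N_nn: "0 \<le> N f" for f
    unfolding N_def using J by (intro Max_ge) auto
  define V where "V x j = x m * w j + (\<Sum>k<m. x k * v k j)" for x :: "nat \<Rightarrow> real" and j
  have hom_le: "N (V (\<lambda>k. r * x k)) \<le> \<bar>r\<bar> * N (V x)" for r x
  proof (rule N_le)
    fix j assume "j \<in> J"
    have "V (\<lambda>k. r * x k) j = r * V x j" by (simp add: V_def sum_distrib_left algebra_simps)
    then show "\<bar>V (\<lambda>k. r * x k) j\<bar> \<le> \<bar>r\<bar> * N (V x)"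
      using N_ge[OF \<open>j \<in> J\<close>, of "V x"] by (simp add: abs_mult mult_left_mono)
  qed (simp add: N_nn)
  have hom: "N (V (\<lambda>k. r * x k)) = \<bar>r\<bar> * N (V x)" for r x
  proof (rule antisym[OF hom_le])
    show "\<bar>r\<bar> * N (V x) \<le> N (V (\<lambda>k. r * x k))"
    proof (cases "r = 0")
      case False
      have "N (V x) = N (V (\<lambda>k. 1 / r * (r * x k)))" using False by simp
      also have "\<dots> \<le> \<bar>1 / r\<bar> * N (V (\<lambda>k. r * x k))" by (rule hom_le)
      finally show ?thesis using False by (simp add: field_simps)
    qed (simp add: N_nn)
  qed
  have tri: "N (V (\<lambda>k. x k + y k)) \<le> N (V x) + N (V y)" for x y
  proof (rule N_le)
    fix j assume "j \<in> J"
    have "V (\<lambda>k. x k + y k) j = V x j + V y j" by (simp add: V_def sum.distrib algebra_simps)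
    then show "\<bar>V (\<lambda>k. x k + y k) j\<bar> \<le> N (V x) + N (V y)"
      using N_ge[OF \<open>j \<in> J\<close>, of "V x"] N_ge[OF \<open>j \<in> J\<close>, of "V y"] by linarith
  qed (simp add: N_nn)
  define e where "e k = (if k = m then 1 else 0 :: real)" for k :: nat
  obtain y where y: "\<And>k. k \<ge> m \<Longrightarrow> y k = 0"
    "\<And>z. (\<forall>k\<ge>m. z k = 0) \<Longrightarrow> N (V (\<lambda>k. e k + y k)) \<le> N (V (\<lambda>k. e k + z k))"
    using seminorm_best_approx[of "\<lambda>x. N (V x)" m e, OF tri hom] by blast
  have Ve: "V (\<lambda>k. e k + z k) = (\<lambda>j. w j + (\<Sum>k<m. z k * v k j))" if "z m = 0" for z
    using that by (auto simp: V_def e_def fun_eq_iff)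
  show ?thesis
  proof (intro exI[of _ y] allI)
    fix c'
    have "N (V (\<lambda>k. e k + y k)) \<le> N (V (\<lambda>k. e k + (if k < m then c' k else 0)))"
      by (rule y(2)) simp
    then show "N (\<lambda>j. w j + (\<Sum>k<m. y k * v k j)) \<le> N (\<lambda>j. w j + (\<Sum>k<m. c' k * v k j))"
      by (simp add: Ve y(1))
  qed
qed

section \<open>The filter polynomial and the estimate\<close>

lemma spectrum_eq_char_poly_roots:
  fixes A :: "real mat"
  assumes "A \<in> carrier_mat n n" "char_poly A = (\<Prod>j=1..n. [:- lam j, 1:])"
  shows "spectrum A = lam ` {1..n}"
proof -
  have "k \<in> spectrum A \<longleftrightarrow> (\<exists>j\<in>{1..n}. k = lam j)" for k
    by (simp add: spectrum_def eigenvalue_root_char_poly[OF assms(1)] assms(2) poly_prod)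
  then show ?thesis by blast
qed

text \<open>Only the eigenvalues nearest to the ends enter the definition; monotonicity of arccos
  passes their distances on to all others, with the signs resolved.\<close>

lemma Delta_min_bounds:
  fixes A :: "real mat"
  assumes fin: "finite (spectrum A)" and sp: "spectrum A \<subseteq> {-1..1}"
    and ab: "-1 \<le> a" "a < b" "b \<le> 1"
  shows Delta_min_pos: "0 < Delta_min A a b"
    and Delta_min_inner: "\<And>x. x \<in> spectrum A \<Longrightarrow> a < x \<Longrightarrow> x < b \<Longrightarrow>
      Delta_min A a b \<le> arccos a - arccos x \<and> Delta_min A a b \<le> arccos x - arccos b"
    and Delta_min_below: "\<And>x. x \<in> spectrum A \<Longrightarrow> x < a \<Longrightarrow> Delta_min A a b \<le> arccos x - arccos a"
    and Delta_min_above: "\<And>x. x \<in> spectrum A \<Longrightarrow> b < x \<Longrightarrow> Delta_min A a b \<le> arccos b - arccos x"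
proof -
  define inner below above where "inner = {x \<in> spectrum A. a < x \<and> x < b}"
    and "below = {x \<in> spectrum A. x < a}" and "above = {x \<in> spectrum A. b < x}"
  have fins: "finite inner" "finite below" "finite above"
    using fin by (auto simp: inner_def below_def above_def)
  define E where "E = end_distances A a b"
  have E: "E = (if inner = {} then {}
         else {\<bar>arccos a - arccos (Min inner)\<bar>, \<bar>arccos b - arccos (Max inner)\<bar>})
        \<union> (if below = {} then {} else {\<bar>arccos a - arccos (Max below)\<bar>})
        \<union> (if above = {} then {} else {\<bar>arccos b - arccos (Min above)\<bar>})"
    unfolding E_def end_distances_def inner_def below_def above_def Let_def by (rule refl)
  have finE: "finite (insert pi E)" unfolding E by auto
  have le: "Delta_min A a b \<le> y" if "y \<in> E" for y
    unfolding Delta_min_def E_def[symmetric] using finE that by (intro Min_le) auto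
  have less: "arccos y < arccos x" if "x < y" "-1 \<le> x" "y \<le> 1" for x y
    using that by (intro arccos_less_arccos) auto
  have mono: "arccos y \<le> arccos x" if "x \<le> y" "-1 \<le> x" "y \<le> 1" for x y
    using that by (intro arccos_le_arccos) auto
  have mem: "inner \<noteq> {} \<Longrightarrow> Min inner \<in> inner" "inner \<noteq> {} \<Longrightarrow> Max inner \<in> inner"
    "below \<noteq> {} \<Longrightarrow> Max below \<in> below" "above \<noteq> {} \<Longrightarrow> Min above \<in> above"
    using fins by auto
  have "0 < y" if "y \<in> E" for y
  proof -
    have ne: "0 < \<bar>arccos e - arccos z\<bar>" if "z < e \<or> e < z" "e \<in> {-1..1}" "z \<in> {-1..1}" for e z
      using that less[of e z] less[of z e] by auto
    have e: "a \<in> {-1..1}" "b \<in> {-1..1}" using ab by auto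
    have "inner \<noteq> {} \<and> y = \<bar>arccos a - arccos (Min inner)\<bar>
      \<or> inner \<noteq> {} \<and> y = \<bar>arccos b - arccos (Max inner)\<bar>
      \<or> below \<noteq> {} \<and> y = \<bar>arccos a - arccos (Max below)\<bar>
      \<or> above \<noteq> {} \<and> y = \<bar>arccos b - arccos (Min above)\<bar>"
      using that unfolding E Un_iff
      by (cases "inner = {}"; cases "below = {}"; cases "above = {}"; simp)
    then consider "inner \<noteq> {}" "y = \<bar>arccos a - arccos (Min inner)\<bar>"
      | "inner \<noteq> {}" "y = \<bar>arccos b - arccos (Max inner)\<bar>"
      | "below \<noteq> {}" "y = \<bar>arccos a - arccos (Max below)\<bar>"
      | "above \<noteq> {}" "y = \<bar>arccos b - arccos (Min above)\<bar>"
      by blast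
    then show ?thesis
    proof cases
      case 1
      then have "a < Min inner" "Min inner \<in> spectrum A" using mem(1) by (auto simp: inner_def)
      then show ?thesis unfolding 1(2) using ne e(1) sp by blast
    next
      case 2
      then have "Max inner < b" "Max inner \<in> spectrum A" using mem(2) by (auto simp: inner_def)
      then show ?thesis unfolding 2(2) using ne e(2) sp by blast
    next
      case 3
      then have "Max below < a" "Max below \<in> spectrum A" using mem(3) by (auto simp: below_def)
      then show ?thesis unfolding 3(2) using ne e(1) sp by blast
    next
      case 4
      then have "b < Min above" "Min above \<in> spectrum A" using mem(4) by (auto simp: above_def)
      then show ?thesis unfolding 4(2) using ne e(2) sp by blast
    qed
  qed
  then show "0 < Delta_min A a b"
    unfolding Delta_min_def E_def[symmetric] using finE by (subst Min_gr_iff) auto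
  fix x assume x: "x \<in> spectrum A"
  then have x1: "-1 \<le> x" "x \<le> 1" using sp by auto
  show "Delta_min A a b \<le> arccos a - arccos x \<and> Delta_min A a b \<le> arccos x - arccos b"
    if "a < x" "x < b"
  proof -
    have xi: "x \<in> inner" using x that by (simp add: inner_def)
    then have ne: "inner \<noteq> {}" by auto
    have m: "Min inner \<le> x" "x \<le> Max inner" using xi fins by auto
    have "a < Min inner" "Max inner < b" using mem(1,2)[OF ne] by (auto simp: inner_def)
    then have "arccos x \<le> arccos (Min inner)" "arccos (Min inner) < arccos a"
      "arccos (Max inner) \<le> arccos x" "arccos b < arccos (Max inner)"
      using m x1 ab by (auto intro!: mono less)
    moreover have "Delta_min A a b \<le> \<bar>arccos a - arccos (Min inner)\<bar>"
      "Delta_min A a b \<le> \<bar>arccos b - arccos (Max inner)\<bar>"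
      by (rule le, simp add: E ne)+
    ultimately show ?thesis by auto
  qed
  show "Delta_min A a b \<le> arccos x - arccos a" if "x < a"
  proof -
    have xi: "x \<in> below" using x that by (simp add: below_def)
    then have ne: "below \<noteq> {}" by auto
    have "x \<le> Max below" "Max below < a" using xi fins mem(3)[OF ne] by (auto simp: below_def)
    then have "arccos (Max below) \<le> arccos x" "arccos a < arccos (Max below)"
      using x1 ab by (auto intro!: mono less)
    moreover have "Delta_min A a b \<le> \<bar>arccos a - arccos (Max below)\<bar>"
      by (rule le, simp add: E ne)+
    ultimately show ?thesis by auto
  qed
  show "Delta_min A a b \<le> arccos b - arccos x" if "b < x"
  proof -
    have xi: "x \<in> above" using x that by (simp add: above_def)
    then have ne: "above \<noteq> {}" by auto
    have "Min above \<le> x" "b < Min above" using xi fins mem(4)[OF ne] by (auto simp: above_def)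
    then have "arccos x \<le> arccos (Min above)" "arccos (Min above) < arccos b"
      using x1 ab by (auto intro!: mono less)
    moreover have "Delta_min A a b \<le> \<bar>arccos b - arccos (Min above)\<bar>"
      by (rule le, simp add: E ne)+
    ultimately show ?thesis by auto
  qed
qed

text \<open>Converts a bound on algebraic multiplicity into a bound on the number of equal
  labels.\<close>

lemma order_prod_linear_ge:
  fixes lam :: "nat \<Rightarrow> real"
  assumes "finite I" "S \<subseteq> I" "\<And>j. j \<in> S \<Longrightarrow> lam j = x"
  shows "card S \<le> Polynomial.order x (\<Prod>j\<in>I. [:- lam j, 1:])"
proof -
  have "(\<Prod>j\<in>S. [:- lam j, 1:]) = [:- x, 1:] ^ card S"
    using assms(3) by simp
  then have "[:- x, 1:] ^ card S dvd (\<Prod>j\<in>I. [:- lam j, 1:])"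
    using prod_dvd_prod_subset[OF assms(1,2), of "\<lambda>j. [:- lam j, 1:]"] by simp
  moreover have "(\<Prod>j\<in>I. [:- lam j, 1:]) \<noteq> 0" using assms(1) by simp
  ultimately show ?thesis by (simp add: order_divides)
qed

text \<open>The supremum ranges over the open interval; continuity extends the bound to the ends,
  which may be eigenvalues.\<close>

lemma abs_m_poly_le_kappa:
  assumes "a < b" "t \<in> {a..b}"
  shows "\<bar>poly (m_poly lam i) t\<bar> / \<bar>poly (m_poly lam i) (lam i)\<bar> \<le> kappa a b lam i"
proof -
  define f where "f t = \<bar>poly (m_poly lam i) t\<bar>" for t
  have cf: "continuous_on S f" for S unfolding f_def by (intro continuous_intros)
  have "bounded (f ` {a..b})"
    by (intro compact_imp_bounded compact_continuous_image cf) auto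
  then have "bdd_above (f ` {a<..<b})"
    by (rule bdd_above_mono[OF bounded_imp_bdd_above]) auto
  then have "f y \<le> (SUP t\<in>{a<..<b}. f t)" if "y \<in> {a<..<b}" for y
    using that by (intro cSUP_upper)
  then have "norm (f t) \<le> (SUP t\<in>{a<..<b}. f t)"
    using assms by (intro continuous_on_closure_norm_le[OF cf, of "{a<..<b}"]) (auto simp: f_def)
  then show ?thesis
    unfolding kappa_def by (intro divide_right_mono) (auto simp: f_def)
qed

lemma degree_m_poly: "degree (m_poly lam i) = card (Xi lam i)"
  unfolding m_poly_def by (subst degree_prod_eq_sum_degree) auto

text \<open>The witness annihilates \<open>\<lambda>\<^sub>1, \<dots>, \<lambda>\<^sub>i\<^sub>-\<^sub>1\<close>; its Chebyshev factor is at most \<open>1\<close> on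
  \<open>[a, \<lambda>\<^sub>i\<^sub>+\<^sub>l]\<close> and grows to the right of it.  If \<open>\<lambda>\<^sub>i\<^sub>+\<^sub>l = a\<close>, division by zero turns
  that factor into the constant \<open>1\<close>.\<close>

lemma filter_poly_exists:
  fixes lam :: "nat \<Rightarrow> real"
  assumes ab: "a < b" and i: "1 \<le> i" "i \<le> nev"
    and mem: "\<And>j. j \<in> {1..nev} \<Longrightarrow> lam j \<in> {a..b}"
    and dec: "\<And>j k. 1 \<le> j \<Longrightarrow> j \<le> k \<Longrightarrow> k \<le> nev \<Longrightarrow> lam k \<le> lam j"
    and gap: "i > 1 \<Longrightarrow> lam (i - 1) \<noteq> lam i" "i + l \<le> nev \<Longrightarrow> lam (i + l) \<noteq> lam i"
    and card: "card (Xi lam i) \<le> M - 1" and M: "M \<ge> 2"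
  obtains p where "degree p \<le> M - 1" "poly p (lam i) = 1"
    "\<And>t. t \<in> {a..b} \<Longrightarrow> \<bar>poly p t\<bar> \<le> tau a b lam nev M l i"
    "\<And>j. j \<in> {1..nev} - {i..<i + l} \<Longrightarrow> \<bar>poly p (lam j)\<bar> \<le> eps a b lam nev M l i"
    "0 \<le> eps a b lam nev M l i"
proof -
  define m where "m = m_poly lam i"
  define \<kappa> where "\<kappa> = kappa a b lam i"
  have poly_m: "poly m t = (\<Prod>x\<in>Xi lam i. t - x)" for t
    by (simp add: m_def m_poly_def poly_prod)
  have finXi: "finite (Xi lam i)" by (simp add: Xi_def)
  have "lam i \<notin> Xi lam i"
  proof
    assume "lam i \<in> Xi lam i"
    then obtain j where j: "1 \<le> j" "j < i" "lam j = lam i" by (auto simp: Xi_def)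
    then have "lam i \<le> lam (i - 1)" "lam (i - 1) \<le> lam j"
      using i dec[of "i - 1" i] dec[of j "i - 1"] by auto
    then show False using gap(1) j by auto
  qed
  then have mi: "poly m (lam i) \<noteq> 0" using finXi by (auto simp: poly_m)
  have mj: "poly m (lam j) = 0" if "j \<in> {1..<i}" for j
    using that finXi by (auto simp: poly_m Xi_def)
  have mk: "\<bar>poly m t\<bar> / \<bar>poly m (lam i)\<bar> \<le> \<kappa>" if "t \<in> {a..b}" for t
    using abs_m_poly_le_kappa[OF ab that] by (simp add: m_def \<kappa>_def)
  have li: "lam i \<in> {a..b}" using mem i by auto
  have \<kappa>: "0 \<le> \<kappa>" using mk[OF li] mi by simp
  show thesis
  proof (cases "i + l \<le> nev")
    case False
    \<comment> \<open>Fewer than l labels follow i within the interval, so every index outside the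
      block is below i, where m vanishes.\<close>
    define p where "p = Polynomial.smult (1 / poly m (lam i)) m"
    show thesis
    proof (rule that[of p])
      show "degree p \<le> M - 1"
        using card by (simp add: p_def m_def degree_m_poly)
      show "poly p (lam i) = 1" using mi by (simp add: p_def)
      show "\<bar>poly p t\<bar> \<le> tau a b lam nev M l i" if "t \<in> {a..b}" for t
        using mk[OF that] False by (simp add: p_def tau_def \<kappa>_def)
      show "\<bar>poly p (lam j)\<bar> \<le> eps a b lam nev M l i" if "j \<in> {1..nev} - {i..<i + l}" for j
        using that False mj[of j] by (auto simp: p_def eps_def)
      show "0 \<le> eps a b lam nev M l i" using False by (simp add: eps_def)
    qed
  next
    case True
    define q where "q = lam (i + l)"
    have q: "a \<le> q" "q < lam i" "lam i \<le> b"
      using mem[of "i + l"] mem[of i] dec[of i "i + l"] gap(2) i True by (auto simp: q_def)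
    \<comment> \<open>Slope of the affine map taking q to 1 and, if q > a, a to -1. Its value at
      \<open>lam i\<close> is \<open>sigma\<close>.\<close>
    define c where "c = 2 / (q - a)"
    have c: "0 \<le> c" using q by (simp add: c_def)
    \<comment> \<open>An inequality, so that the degenerate case q = a with c = 0 is
      included.\<close>
    have c2: "(q - a) * c \<le> 2"
    proof (cases "q = a")
      case False
      then have "q - a \<noteq> 0" by simp
      then have "(q - a) * 2 / (q - a) = 2" by (rule nonzero_mult_div_cancel_left)
      then show ?thesis by (simp only: c_def times_divide_eq_right)
    qed simp
    define k where "k = M - card (Xi lam i) - 1"
    define T where "T t = poly (cheb_T k) (1 + (t - q) * c)" for t
    define r where "r = [:1 - q * c, c:]"
    have Tr: "poly (pcompose (cheb_T k) r) t = T t" for t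
      by (simp add: poly_pcompose r_def T_def algebra_simps)
    have Tle: "\<bar>T t\<bar> \<le> 1" if "a \<le> t" "t \<le> q" for t
    proof -
      have "(q - t) * c \<le> (q - a) * c" "0 \<le> (q - t) * c" using that c by (auto intro: mult_right_mono)
      moreover have "(t - q) * c = - ((q - t) * c)" by (simp add: algebra_simps)
      ultimately show ?thesis unfolding T_def using c2 by (intro abs_poly_cheb_T_le_1) linarith
    qed
    have Tge: "1 \<le> T t" if "q \<le> t" for t
      using that c unfolding T_def by (intro poly_cheb_T_ge_1) simp
    have Tb: "\<bar>T t\<bar> \<le> T b" if "t \<in> {a..b}" for t
    proof (cases "t \<le> q")
      case True
      then show ?thesis using Tle[of t] Tge[of b] that q by auto
    next
      case False
      then have "T t \<le> T b" unfolding T_def using that c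
        by (intro poly_cheb_T_mono) (auto intro: mult_right_mono)
      then show ?thesis using Tge[of t] False by simp
    qed
    have Ti: "1 \<le> T (lam i)" using Tge q by simp
    have eps: "eps a b lam nev M l i = \<kappa> / T (lam i)"
      using True by (simp add: eps_def \<kappa>_def T_def k_def sigma_def q_def c_def mult.commute)
    have tau: "tau a b lam nev M l i = \<kappa> / T (lam i) * T b"
      using True by (simp add: tau_def eps T_def k_def q_def c_def mult.commute)
    define p where "p = Polynomial.smult (1 / (poly m (lam i) * T (lam i))) (m * pcompose (cheb_T k) r)"
    have p: "poly p t = poly m t / poly m (lam i) * (T t / T (lam i))" for t
      by (simp add: p_def Tr)
    show thesis
    proof (rule that[of p])
      have "degree (pcompose (cheb_T k) r) \<le> k * 1"
        by (rule order_trans[OF degree_pcompose_le mult_le_mono[OF degree_cheb_T_le]]) (simp add: r_def)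
      then have "degree (m * pcompose (cheb_T k) r) \<le> card (Xi lam i) + k"
        by (intro order_trans[OF degree_mult_le]) (simp add: m_def degree_m_poly)
      then show "degree p \<le> M - 1"
        using card by (auto simp: p_def k_def intro: order_trans[OF degree_smult_le])
      show "poly p (lam i) = 1" using mi Ti by (simp add: p)
      show "\<bar>poly p t\<bar> \<le> tau a b lam nev M l i" if t: "t \<in> {a..b}" for t
      proof -
        have "\<bar>poly p t\<bar> = \<bar>poly m t\<bar> / \<bar>poly m (lam i)\<bar> * (\<bar>T t\<bar> / T (lam i))"
          using Ti by (simp add: p abs_mult)
        also have "\<dots> \<le> \<kappa> * (T b / T (lam i))"
          using mk[OF t] Tb[OF t] Ti \<kappa> by (intro mult_mono divide_right_mono) auto
        finally show ?thesis by (simp add: tau)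
      qed
      show "\<bar>poly p (lam j)\<bar> \<le> eps a b lam nev M l i" if j: "j \<in> {1..nev} - {i..<i + l}" for j
      proof (cases "j < i")
        case True
        then show ?thesis using j mj[of j] \<kappa> Ti by (simp add: p eps)
      next
        case False
        then have "lam j \<le> q" using j i True dec[of "i + l" j] by (auto simp: q_def)
        then have 1: "\<bar>T (lam j)\<bar> \<le> 1" using mem[of j] j by (intro Tle) auto
        have "\<bar>poly p (lam j)\<bar> = \<bar>poly m (lam j)\<bar> / \<bar>poly m (lam i)\<bar> * (\<bar>T (lam j)\<bar> / T (lam i))"
          using Ti by (simp add: p abs_mult)
        also have "\<dots> \<le> \<kappa> * (1 / T (lam i))"
          using mk[of "lam j"] mem[of j] j 1 Ti \<kappa> by (intro mult_mono divide_right_mono) auto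
        finally show ?thesis by (simp add: eps)
      qed
      show "0 \<le> eps a b lam nev M l i" using \<kappa> Ti by (simp add: eps)
    qed
  qed
qed

section \<open>Attainment of the minimum\<close>

lemma CJ_minimizer_exists:
  assumes ab: "-1 \<le> a" "a < b" "b \<le> 1" and M: "M \<ge> 1" and p0: "CJ_admissible a b d lam M i p0"
  shows "\<exists>p. is_arg_min (CJ_max_ratio a b d lam n l i) (CJ_admissible a b d lam M i) p"
proof -
  define G where "G p j = poly (CJ_series a b d p) (lam j)" for p j
  define J where "J = {1..n} - {i..<i + l}"
  define N where "N f = Max (insert 0 ((\<lambda>j. \<bar>f j\<bar>) ` J))" for f :: "nat \<Rightarrow> real"
  have G_add: "G (p + q) j = G p j + G q j" for p q j
    by (simp add: G_def CJ_series_add[OF ab])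
  have G_smult: "G (Polynomial.smult r p) j = r * G p j" for r p j
    by (simp add: G_def CJ_series_smult[OF ab])
  have G_diff: "G (p - q) j = G p j - G q j" for p q j
    using G_add[of p "Polynomial.smult (-1) q" j] G_smult[of "-1" q j] by simp
  have G_0: "G 0 j = 0" for j using G_smult[of 0 0 j] by simp
  have G_sum: "G (\<Sum>k\<in>S. f k) j = (\<Sum>k\<in>S. G (f k) j)" for f :: "nat \<Rightarrow> real poly" and S j
    by (induction S rule: infinite_finite_induct) (simp_all add: G_0 G_add)
  have ratio: "CJ_max_ratio a b d lam n l i p = N (\<lambda>j. G p j / G p i)" for p
    by (simp add: CJ_max_ratio_def N_def G_def J_def)
  have adm: "CJ_admissible a b d lam M i p \<longleftrightarrow> degree p \<le> M - 1 \<and> G p i \<noteq> 0" for p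
    by (simp add: CJ_admissible_def G_def)
  define p1 where "p1 = Polynomial.smult (1 / G p0 i) p0"
  have p1: "degree p1 \<le> M - 1" "G p1 i = 1"
    using p0 by (auto simp: adm p1_def G_smult intro: order_trans[OF degree_smult_le])
  \<comment> \<open>Values of the series of monomials corrected by a multiple of p1 so as to vanish
    at index i; any coefficients thus preserve the normalisation.\<close>
  define v where "v k j = G (Polynomial.monom 1 k) j - G (Polynomial.monom 1 k) i * G p1 j" for k j
  obtain c where c: "\<And>c'. N (\<lambda>j. G p1 j + (\<Sum>k<M. c k * v k j)) \<le> N (\<lambda>j. G p1 j + (\<Sum>k<M. c' k * v k j))"
    using max_norm_best_approx[where J = J and w = "G p1" and m = M and v = v]
    unfolding N_def J_def by auto
  define p where "p = p1 + (\<Sum>k<M. Polynomial.smult (c k)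
    (Polynomial.monom 1 k - Polynomial.smult (G (Polynomial.monom 1 k) i) p1))"
  have Gp: "G p j = G p1 j + (\<Sum>k<M. c k * v k j)" for j
    by (simp add: p_def G_add G_diff G_sum G_smult v_def)
  have Gpi: "G p i = 1" by (simp add: Gp v_def p1)
  have "degree p \<le> M - 1"
    unfolding p_def using M p1(1)
    by (intro degree_add_le degree_sum_le)
      (auto intro!: order_trans[OF degree_smult_le] degree_diff_le order_trans[OF degree_monom_le])
  then have "CJ_admissible a b d lam M i p" by (simp add: adm Gpi)
  moreover have "CJ_max_ratio a b d lam n l i p \<le> CJ_max_ratio a b d lam n l i y"
    if y: "CJ_admissible a b d lam M i y" for y
  proof -
    \<comment> \<open>The competitor after normalisation. Its own monomial coefficients represent it
      in the affine family, since the p1 contributions cancel by G z i = 1.\<close>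
    define z where "z = Polynomial.smult (1 / G y i) y"
    have Gz: "G z j = G y j / G y i" for j by (simp add: z_def G_smult)
    have zi: "G z i = 1" using y by (simp add: Gz adm)
    have "degree z \<le> M - 1" using y by (auto simp: z_def adm intro: order_trans[OF degree_smult_le])
    then have "z = (\<Sum>k\<le>M-1. Polynomial.smult (Polynomial.coeff z k) (Polynomial.monom 1 k))"
      by (subst poly_as_sum_of_monoms'[symmetric, of z "M - 1"]) (simp_all add: smult_monom)
    moreover have "{..M - 1} = {..<M}" using M by auto
    ultimately have exp: "G z j = (\<Sum>k<M. Polynomial.coeff z k * G (Polynomial.monom 1 k) j)" for j
      by (metis (no_types, lifting) G_sum G_smult sum.cong)
    have "G p1 j + (\<Sum>k<M. Polynomial.coeff z k * v k j) = G z j" for j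
    proof -
      have "(\<Sum>k<M. Polynomial.coeff z k * v k j) = G z j - G z i * G p1 j"
        unfolding v_def right_diff_distrib sum_subtractf exp by (simp add: sum_distrib_right mult.assoc)
      then show ?thesis by (simp add: zi)
    qed
    then show ?thesis
      using c[of "Polynomial.coeff z"] by (simp add: ratio Gp[symmetric] Gpi Gz)
  qed
  ultimately show ?thesis by (auto simp: is_arg_min_def not_less intro!: exI[of _ p])
qed

text \<open>The three error terms are fixed multiples of positive powers of 1/(d+2), so the limit is
  1 or 1/2, and 1/4 lies below both.\<close>

lemma nu_eventually_ge:
  "\<forall>\<^sub>F d in sequentially. 1 / 4 \<le> nu A a b lam nev M l i d"
proof -
  define X where "X d = inverse (real (d + 2))" for d
  have X: "X \<longlonglongrightarrow> 0"
  proof -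
    have "X = (\<lambda>d. inverse (real (Suc (d + 1))))" by (simp add: X_def fun_eq_iff)
    moreover have "\<dots> \<longlonglongrightarrow> 0"
      by (rule LIMSEQ_ignore_initial_segment[OF LIMSEQ_inverse_real_of_nat])
    ultimately show ?thesis by (simp only:)
  qed
  define \<tau> where "\<tau> = tau a b lam nev M l i"
  define g h e where "g = pi ^ 6 * \<tau> / Delta_min A a b ^ 4"
    and "h = (pi\<^sup>2 * (real M - 1)\<^sup>2 / (b - a))\<^sup>2 * (\<tau> / 2)"
    and "e = pi\<^sup>2 * (real M - 1)\<^sup>2 / (b - a) * (\<tau> / 2)"
  have G: "gamma_hat A a b lam nev M l i d = g * X d ^ 3" for d
    by (simp only: gamma_hat_def g_def X_def \<tau>_def divide_inverse power_inverse
        inverse_mult_distrib mult_ac)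
  have H: "delta_hat a b lam nev M l i d = h * (X d)\<^sup>2" for d
    by (simp only: delta_hat_def h_def X_def \<tau>_def divide_inverse power_inverse
        inverse_mult_distrib power_mult_distrib mult_ac)
  have E: "eta_hat a b lam nev M l i d = e * X d" for d
    by (simp only: eta_hat_def e_def X_def \<tau>_def divide_inverse inverse_mult_distrib mult_ac)
  define in_int where "in_int \<longleftrightarrow> a < lam i \<and> lam i < b"
  have nu: "(\<lambda>d. nu A a b lam nev M l i d) = (\<lambda>d. if in_int then 1 - g * X d ^ 3 - h * (X d)\<^sup>2
      else 1 / 2 - g * X d ^ 3 - e * X d)"
    unfolding nu_def G H E in_int_def by (rule refl)
  have "(\<lambda>d. 1 - g * X d ^ 3 - h * (X d)\<^sup>2) \<longlonglongrightarrow> 1 - g * 0 ^ 3 - h * 0\<^sup>2"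
    by (intro tendsto_intros X)
  moreover have "(\<lambda>d. 1 / 2 - g * X d ^ 3 - e * X d) \<longlonglongrightarrow> 1 / 2 - g * 0 ^ 3 - e * 0"
    by (intro tendsto_intros X)
  ultimately have "(\<lambda>d. nu A a b lam nev M l i d) \<longlonglongrightarrow> (if in_int then 1 else 1 / 2)"
    unfolding nu by (cases in_int) simp_all
  from order_tendstoD(1)[OF this, of "1 / 4"]
  have "\<forall>\<^sub>F d in sequentially. 1 / 4 < nu A a b lam nev M l i d" by (cases in_int) simp_all
  then show ?thesis by (rule eventually_mono) simp
qed

text \<open>Largeness of d is split in two: a uniform positive lower bound for \<open>nu\<close>
  from some d on, and the estimate for every d with positive \<open>nu\<close>. Stating it through
  \<open>is_arg_min\<close> makes the minimum an attained one.\<close>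

theorem theorem4p6:
  fixes A :: "real mat" and lam :: "nat \<Rightarrow> real" and a b :: real
    and n nev M l i :: nat
  assumes "A \<in> carrier_mat n n" and "transpose_mat A = A"
    and "Min (spectrum A) = -1" and "Max (spectrum A) = 1"
    and "M \<ge> 2" and "l \<ge> 1"
    and "a < b" and "{a..b} \<subseteq> {-1..1}"
    and "char_poly A = (\<Prod>j=1..n. [:- lam j, 1:])"
    and "nev \<le> n"
    and "\<And>j. j \<in> {1..nev} \<Longrightarrow> lam j \<in> {a..b}"
    and "\<And>j k. 1 \<le> j \<Longrightarrow> j \<le> k \<Longrightarrow> k \<le> nev \<Longrightarrow> lam k \<le> lam j"
    and "\<And>j. j \<in> {nev<..n} \<Longrightarrow> lam j \<notin> {a..b}"
    and "\<And>j. j \<in> {1..nev} \<Longrightarrow> Polynomial.order (lam j) (char_poly A) \<le> l"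
    and "1 \<le> i" and "i \<le> nev"
    and "i > 1 \<Longrightarrow> lam (i - 1) \<noteq> lam i"
    and "card (Xi lam i) \<le> M - 1"
  shows "(\<exists>c>0. \<forall>\<^sub>F d in sequentially. c \<le> nu A a b lam nev M l i d) \<and>
    (\<forall>d. nu A a b lam nev M l i d > 0 \<longrightarrow>
      (\<exists>p. is_arg_min (CJ_max_ratio a b d lam n l i) (CJ_admissible a b d lam M i) p \<and>
           CJ_max_ratio a b d lam n l i p
             \<le> mu A a b lam nev M l i d / nu A a b lam nev M l i d))"
proof (intro conjI allI impI)
  show "\<exists>c>0. \<forall>\<^sub>F d in sequentially. c \<le> nu A a b lam nev M l i d"
    using nu_eventually_ge by (intro exI[of _ "1 / 4"]) simp
  have ab: "-1 \<le> a" "a < b" "b \<le> 1" using assms(7,8) by auto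
  have M: "M \<ge> 2" using assms(5) .
  have sp: "spectrum A = lam ` {1..n}"
    by (rule spectrum_eq_char_poly_roots[OF assms(1,9)])
  have n: "1 \<le> n" using assms(10,15,16) by linarith
  have fin: "finite (spectrum A)" "spectrum A \<noteq> {}" using n by (auto simp: sp)
  have sp1: "spectrum A \<subseteq> {-1..1}"
    using Min_le[OF fin(1)] Max_ge[OF fin(1)] assms(3,4) by auto
  have poles: "-1 \<in> spectrum A" "1 \<in> spectrum A"
    using Min_in[OF fin] Max_in[OF fin] assms(3,4) by auto
  define \<Delta> where "\<Delta> = Delta_min A a b"
  note \<Delta> = Delta_min_bounds[OF fin(1) sp1 ab, folded \<Delta>_def]
  \<comment> \<open>By monotonicity equality would make l + 1 labels coincide, against the
    multiplicity bound.\<close>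
  have gap: "lam (i + l) \<noteq> lam i" if "i + l \<le> nev"
  proof
    assume eq: "lam (i + l) = lam i"
    have same: "lam j = lam i" if "j \<in> {i..i + l}" for j
      using that assms(12)[of i j] assms(12)[of j "i + l"] assms(15) \<open>i + l \<le> nev\<close> eq by auto
    have "{i..i + l} \<subseteq> {1..n}" using assms(10,15) that by auto
    then have "card {i..i + l} \<le> Polynomial.order (lam i) (char_poly A)"
      unfolding assms(9) by (intro order_prod_linear_ge same) auto
    then show False using assms(14)[of i] assms(15,16) by simp
  qed
  fix d assume nu_pos: "0 < nu A a b lam nev M l i d"
  define \<epsilon> \<tau> where "\<epsilon> = eps a b lam nev M l i" and "\<tau> = tau a b lam nev M l i"
  obtain p where p: "degree p \<le> M - 1" "poly p (lam i) = 1"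
    "\<And>t. t \<in> {a..b} \<Longrightarrow> \<bar>poly p t\<bar> \<le> \<tau>"
    "\<And>j. j \<in> {1..nev} - {i..<i + l} \<Longrightarrow> \<bar>poly p (lam j)\<bar> \<le> \<epsilon>" "0 \<le> \<epsilon>"
    by (rule filter_poly_exists[OF ab(2) assms(15,16,11,12,17) gap assms(18) M, folded \<epsilon>_def \<tau>_def])
      (assumption | rule that | blast)+
  have li: "lam i \<in> {a..b}" using assms(11,15,16) by auto
  have \<tau>: "1 \<le> \<tau>" using p(3)[OF li] p(2) by simp
  define g h e x where "g = gamma_hat A a b lam nev M l i d" and "h = delta_hat a b lam nev M l i d"
    and "e = eta_hat a b lam nev M l i d"
    and "x = pi\<^sup>2 * (real (M - 1))\<^sup>2 / ((b - a) * real (d + 2))"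
  have M1: "real M - 1 = real (M - 1)" using M by simp
  have geq: "g = pi ^ 6 * \<tau> / (\<Delta> ^ 4 * real (d + 2) ^ 3)"
    by (simp add: g_def gamma_hat_def \<tau>_def \<Delta>_def)
  have heq: "h = x\<^sup>2 * (\<tau> / 2)" by (simp add: h_def delta_hat_def x_def \<tau>_def M1)
  have eeq: "e = x * (\<tau> / 2)" by (simp add: e_def eta_hat_def x_def \<tau>_def M1)
  have g: "0 \<le> g" using \<tau> \<Delta>(1) by (simp add: geq)
  have x: "0 \<le> x" using ab by (simp add: x_def)
  have h: "0 \<le> h" "0 \<le> e" using \<tau> x by (auto simp: heq eeq)
  have xle: "x \<le> x * \<tau>" "x\<^sup>2 \<le> x\<^sup>2 * \<tau>" using mult_left_mono[OF \<tau> x] mult_left_mono[OF \<tau>, of "x\<^sup>2"] by auto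
  have \<nu>: "nu A a b lam nev M l i d = (if a < lam i \<and> lam i < b then 1 - g - h else 1 / 2 - g - e)"
    by (simp add: nu_def g_def h_def e_def)
  have x_end: "x * \<tau> < 1" if "\<not> (a < lam i \<and> lam i < b)"
    using nu_pos g that by (simp add: \<nu> eeq)
  \<comment> \<open>Positivity of \<open>nu\<close> gives h < 1 at an inner point and e < 1/2 at an
    end; \<tau> >= 1 then bounds x alone.\<close>
  have x2: "x\<^sup>2 < 2"
  proof (cases "a < lam i \<and> lam i < b")
    case True
    then have "x\<^sup>2 * \<tau> < 2" using nu_pos g by (simp add: \<nu> heq)
    then show ?thesis using xle by linarith
  next
    case False
    then have "x < 1" using x_end xle by linarith
    then have "x\<^sup>2 \<le> 1" using x by (intro power_le_one) auto
    then show ?thesis by simp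
  qed
  \<comment> \<open>Provides the moments of the kernel: d < 2 would force x >= 9/6 and x^2 >=
    9/4.\<close>
  have d: "d \<ge> 2"
  proof (rule ccontr)
    assume "\<not> d \<ge> 2"
    then have "real (d + 2) \<le> 3" by simp
    then have "(b - a) * real (d + 2) \<le> 2 * 3" using ab by (intro mult_mono) auto
    moreover have "0 < (b - a) * real (d + 2)" using ab by simp
    moreover have "9 \<le> pi\<^sup>2" using pi_gt3 power_mono[of 3 pi 2] by simp
    moreover have "1 \<le> (real (M - 1))\<^sup>2" using M by (intro one_le_power) simp
    then have "9 * 1 \<le> pi\<^sup>2 * (real (M - 1))\<^sup>2" using \<open>9 \<le> pi\<^sup>2\<close> by (intro mult_mono) auto
    ultimately have "9 * 1 / (2 * 3) \<le> x"
      unfolding x_def by (intro frac_le) auto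
    then have "(3 / 2)\<^sup>2 \<le> x\<^sup>2" by (intro power_mono) auto
    then show False using x2 by (simp add: power2_eq_square)
  qed
  interpret cutoff_poly a b \<tau> p "M - 1" d
    using ab M p d by unfold_locales auto
  define F where "F y = poly (CJ_series a b d p) y" for y
  define \<mu> where "\<mu> = g + max (\<epsilon> + h) (\<epsilon> / 2 + e)"
  have mu: "mu A a b lam nev M l i d = \<mu>"
    by (simp add: mu_def \<mu>_def g_def h_def e_def \<epsilon>_def)
  have \<mu>_ge: "g \<le> \<mu>" "g + (\<epsilon> + h) \<le> \<mu>" "g + (\<epsilon> / 2 + e) \<le> \<mu>"
    using p(5) h by (auto simp: \<mu>_def)
  have outside: "\<bar>F y\<bar> \<le> g" if "y \<in> spectrum A" "y \<notin> {a..b}" for y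
    unfolding F_def geq using that sp1 \<Delta>(1) \<Delta>(3,4)[OF that(1)] by (intro CJ_outside) auto
  have inside: "\<bar>F y - poly p y\<bar> \<le> g + h" if "y \<in> spectrum A" "a < y" "y < b" for y
    unfolding F_def geq heq x_def using that \<Delta>(1) \<Delta>(2)[OF that] by (intro CJ_inside) auto
  \<comment> \<open>The extreme eigenvalue -1 lies below a, hence \<Delta> <= pi - arccos a;
    likewise 1 above b gives \<Delta> <= arccos b.\<close>
  have left: "\<bar>F a - poly p a / 2\<bar> \<le> g + e" if "-1 < a"
    unfolding F_def geq eeq x_def using that \<Delta>(1) \<Delta>(3)[OF poles(1) that] by (intro CJ_left_end) auto
  have right: "\<bar>F b - poly p b / 2\<bar> \<le> g + e" if "b < 1"
    unfolding F_def geq eeq x_def using that \<Delta>(1) \<Delta>(4)[OF poles(2) that] by (intro CJ_right_end) auto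
  have pole: "\<bar>F y - poly p y\<bar> \<le> h" if "y = a \<and> a = -1 \<or> y = b \<and> b = 1" for y
    unfolding F_def heq x_def by (rule CJ_pole[OF that])
  have cases: thesis
    if "y \<notin> {a..b} \<Longrightarrow> thesis" "a < y \<and> y < b \<Longrightarrow> thesis" "y = a \<and> -1 < a \<Longrightarrow> thesis"
      "y = b \<and> b < 1 \<Longrightarrow> thesis" "y = a \<and> a = -1 \<or> y = b \<and> b = 1 \<Longrightarrow> thesis" for y thesis
  proof -
    have "y \<notin> {a..b} \<or> (a < y \<and> y < b) \<or> y = a \<or> y = b" by auto
    moreover have "-1 < a \<or> a = -1" "b < 1 \<or> b = 1" using ab by auto
    ultimately show thesis using that by blast
  qed
  have upper: "\<bar>F (lam j)\<bar> \<le> \<mu>" if j: "j \<in> {1..n} - {i..<i + l}" for j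
  proof -
    have lj: "lam j \<in> spectrum A" using j by (auto simp: sp)
    have pj: "\<bar>poly p (lam j)\<bar> \<le> \<epsilon>" if "lam j \<in> {a..b}"
    proof -
      have "j \<le> nev" using that assms(13)[of j] j by (cases "j \<le> nev") auto
      then show ?thesis using j by (intro p(4)) auto
    qed
    show ?thesis
    proof (rule cases[of "lam j"])
      assume "lam j \<notin> {a..b}"
      then show ?thesis using outside[OF lj] \<mu>_ge by linarith
    next
      assume "a < lam j \<and> lam j < b"
      then show ?thesis using inside[OF lj] pj \<mu>_ge by fastforce
    next
      \<comment> \<open>At such an end F is close to p/2, whence \<epsilon>/2 + e, the second entry
        of the maximum in \<open>mu\<close>.\<close>
      assume "lam j = a \<and> -1 < a"
      then show ?thesis using left pj \<mu>_ge ab by auto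
    next
      assume "lam j = b \<and> b < 1"
      then show ?thesis using right pj \<mu>_ge ab by auto
    next
      assume y: "lam j = a \<and> a = -1 \<or> lam j = b \<and> b = 1"
      then have "lam j \<in> {a..b}" using ab by auto
      then show ?thesis using pole[OF y] pj \<mu>_ge g by linarith
    qed
  qed
  define \<nu>' where "\<nu>' = nu A a b lam nev M l i d"
  have lower: "\<nu>' \<le> \<bar>F (lam i)\<bar>"
  proof -
    have lsp: "lam i \<in> spectrum A" using assms(10,15,16) by (auto simp: sp)
    show ?thesis
    proof (rule cases[of "lam i"])
      assume "lam i \<notin> {a..b}"
      then show ?thesis using li by simp
    next
      assume y: "a < lam i \<and> lam i < b"
      then have "\<bar>F (lam i) - 1\<bar> \<le> g + h" using inside[OF lsp] p(2) by auto
      then show ?thesis using y by (simp add: \<nu>'_def \<nu>)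
    next
      assume y: "lam i = a \<and> -1 < a"
      then have "\<bar>F (lam i) - 1 / 2\<bar> \<le> g + e" using left p(2) by auto
      then show ?thesis using y unfolding \<nu>'_def \<nu> by auto
    next
      assume y: "lam i = b \<and> b < 1"
      then have "\<bar>F (lam i) - 1 / 2\<bar> \<le> g + e" using right p(2) by auto
      then show ?thesis using y unfolding \<nu>'_def \<nu> by auto
    next
      \<comment> \<open>Here F is within h of 1, while \<open>nu\<close> is at most 1/2. So h <= 1/2
        is enough, and it follows from x \<tau> < 1 together with x <= x \<tau>.\<close>
      assume y: "lam i = a \<and> a = -1 \<or> lam i = b \<and> b = 1"
      then have end_i: "\<not> (a < lam i \<and> lam i < b)" by auto
      have 1: "\<bar>F (lam i) - 1\<bar> \<le> h" using pole[OF y] p(2) by simp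
      have "x * (x * \<tau>) \<le> 1 * 1"
        using x_end[OF end_i] xle x by (intro mult_mono) auto
      then have "h \<le> 1 / 2" by (simp add: heq power2_eq_square)
      moreover have "\<nu>' \<le> 1 / 2" using g h unfolding \<nu>'_def \<nu> if_not_P[OF end_i] by linarith
      ultimately show ?thesis using 1 by linarith
    qed
  qed
  have adm: "CJ_admissible a b d lam M i p"
    using p(1) lower nu_pos by (auto simp: CJ_admissible_def \<nu>'_def F_def)
  have "CJ_max_ratio a b d lam n l i p \<le> \<mu> / \<nu>'"
  proof -
    have \<mu>: "0 \<le> \<mu>" using g \<mu>_ge(1) by linarith
    have "\<bar>F (lam j)\<bar> / \<bar>F (lam i)\<bar> \<le> \<mu> / \<nu>'" if "j \<in> {1..n} - {i..<i + l}" for j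
      using upper[OF that] lower nu_pos \<mu> by (intro frac_le) (auto simp: \<nu>'_def)
    then show ?thesis
      using \<mu> nu_pos by (auto simp: CJ_max_ratio_def F_def \<nu>'_def)
  qed
  moreover obtain q where q: "is_arg_min (CJ_max_ratio a b d lam n l i) (CJ_admissible a b d lam M i) q"
    using CJ_minimizer_exists[OF ab _ adm] M by fastforce
  moreover have "CJ_max_ratio a b d lam n l i q \<le> CJ_max_ratio a b d lam n l i p"
    using q adm by (auto simp: is_arg_min_def not_less)
  ultimately show "\<exists>p. is_arg_min (CJ_max_ratio a b d lam n l i) (CJ_admissible a b d lam M i) p \<and>
      CJ_max_ratio a b d lam n l i p \<le> mu A a b lam nev M l i d / nu A a b lam nev M l i d"
    unfolding mu \<nu>'_def[symmetric] by (meson order.trans)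
qed

end
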